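(* Let $A\in\mathbb{R}^{n\times d}$, let $k$ be a positive integer with $k\le \mathrm{rank}(A)$, and let $A_k$ denote a best rank-$k$ approximation of $A$ (in Frobenius norm). Let $\varepsilon,\delta\in(0,1)$, and let $q,\ell$ be positive integers such that $q$ divides $n$, \[ q\ell \;\ge\; \frac{12(k^2+k)}{\varepsilon^2\delta}\qquad\text{and}\qquad \ell=\left\lceil k+\frac{3k}{\varepsilon\delta}\right\rceil . \] Let $S=\mathrm{diag}(S_1,\dots,S_q)\in\mathbb{R}^{q\ell\times n}$ be the random block-diagonal matrix whose blocks $S_i\in\mathbb{R}^{\ell\times n/q}$ are independent sparse subspace embedding (SpEmb) matrices, and let $P$ be an $n\times n$ uniformly random permutation matrix independent of $S$ (so for each $j\in[n]$, $\mathbb{P}[Pe_j=e_i]=1/n$ for all $i\in[n]$). Let $B\in\mathbb{R}^{\ell\times d}$ and $\tilde A_k\in\mathbb{R}^{n\times d}$ be the output of the algorithm SpFD (described in the context) on input $A$, with sketch size $\ell$, rank parameter $k$, number of blocks $q$, and random matrices $S,P$. Then with probability at least $1-\delta$, \[ \|A-\tilde A_k\|_F^2=\|A-\Pi^F_{B,k}(A)\|_F^2\le \|A-A_k\|_F^2+\varepsilon\|A\|_F^2 . \]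
   Context: $[m]=\{1,\dots,m\}$; $e_j$ is the $j$-th column of the identity matrix $I_n$; $\|\cdot\|_F$ is the Frobenius norm. For a matrix $M$, $[M]_k$ (also written $M_k$) denotes a best rank-$k$ approximation of $M$ in Frobenius norm (a minimizer of $\|M-Y\|_F$ over $Y$ with $\mathrm{rank}(Y)\le k$, obtained by truncating the SVD to the top $k$ singular values). For $B\in\mathbb{R}^{\ell\times d}$, $\Pi^F_{B,k}(A)\in\mathbb{R}^{n\times d}$ denotes the best rank-$k$ approximation to $A$ in the row space of $B$ with respect to the Frobenius norm, i.e. a minimizer of $\|A-XB\|_F$ over $X\in\mathbb{R}^{n\times\ell}$ with $\mathrm{rank}(X)\le k$. SpEmb matrix: an $\ell\times m$ SpEmb matrix is a random matrix $\phi D$, where $\phi\in\{0,1\}^{\ell\times m}$ has $\phi_{h(i),i}=1$ for $i\in[m]$ and all other entries $0$, for a random map $h:[m]\to[\ell]$ whose values $h(1),\dots,h(m)$ are independent and uniform on $[\ell]$; and $D$ is an $m\times m$ diagonal matrix, independent of $\phi$, whose diagonal entries are independent and equal to $\pm1$ with probability $1/2$ each. Algorithm SpFD. Partition the rows of $PA$ into $q$ consecutive blocks $(PA)_1,\dots,(PA)_q$ of $n/q$ rows each, so that $SPA\in\mathbb{R}^{q\ell\times d}$ is the vertical stack of the $\ell\times d$ blocks $S_i(PA)_i$. 1. Initialize $B\in\mathbb{R}^{2\ell\times d}$ to be zero, and set its first $\ell$ rows to $S_1(PA)_1$. 2. For $i=1,\dots,q-1$: set the last $\ell$ rows of $B$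 to $S_{i+1}(PA)_{i+1}$; compute a singular value decomposition $B=U\Sigma V^T$ with singular values in non-increasing order $\sigma_1\ge\sigma_2\ge\cdots\ge\sigma_{2\ell}\ge 0$ (padding with zero singular values if $d<2\ell$); set $\delta_i=\sigma_{\ell+1}^2$; and replace $B$ by $\sqrt{\max(\Sigma^2-\delta_i I_{2\ell},0)}\,V^T$, i.e. the matrix whose $j$-th row is $\sqrt{\max(\sigma_j^2-\delta_i,0)}$ times the transpose of the $j$-th right singular vector. (The last $\ell$ rows of the new $B$ are then zero.) 3. Replace $B$ by its first $\ell$ rows, so $B\in\mathbb{R}^{\ell\times d}$. Let $V$ be a matrix whose columns form an orthonormal basis of the row space of $B$ (for $q>1$ these are the leading right singular vectors computed in the last iteration; for $q=1$ the basis is constructed directly from $B$). 4. Compute $[AV]_k$ and output $B$ and $\tilde A_k=[AV]_kV^T$. *)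

theory Defs
  imports
    "HOL-Probability.Product_PMF"
    "HOL-Combinatorics.Permutations"
    "Jordan_Normal_Form.DL_Rank"
begin

definition frob_norm :: "real mat \<Rightarrow> real" where
  "frob_norm M = sqrt (\<Sum>i<dim_row M. \<Sum>j<dim_col M. (M $$ (i, j))\<^sup>2)"

abbreviation mat_rank :: "real mat \<Rightarrow> nat" where
  "mat_rank M \<equiv> vec_space.rank (dim_row M) M"

definition best_rank_approx :: "nat \<Rightarrow> real mat \<Rightarrow> real mat \<Rightarrow> bool" where
  "best_rank_approx k M Y \<longleftrightarrow>
     Y \<in> carrier_mat (dim_row M) (dim_col M) \<and> mat_rank Y \<le> k \<and>
     (\<forall>Z \<in> carrier_mat (dim_row M) (dim_col M).
        mat_rank Z \<le> k \<longrightarrow> frob_norm (M - Y) \<le> frob_norm (M - Z))"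

(* The rank constraint is on the coefficient matrix X; the approximation itself is X * B. *)
definition best_rank_approx_in_rows :: "real mat \<Rightarrow> nat \<Rightarrow> real mat \<Rightarrow> real mat \<Rightarrow> bool" where
  "best_rank_approx_in_rows B k M Y \<longleftrightarrow>
     (\<exists>X \<in> carrier_mat (dim_row M) (dim_row B).
        Y = X * B \<and> mat_rank X \<le> k \<and>
        (\<forall>Z \<in> carrier_mat (dim_row M) (dim_row B).
           mat_rank Z \<le> k \<longrightarrow> frob_norm (M - X * B) \<le> frob_norm (M - Z * B)))"

(* Full singular value decomposition M = U Sigma V^T of a matrix of any shape.  Indices start
   at 0, and the sequence s of singular values is padded by zeros beyond the smaller dimension. *)
definition is_svd :: "real mat \<Rightarrow> real mat \<Rightarrow> (nat \<Rightarrow> real) \<Rightarrow> real mat \<Rightarrow> bool" where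
  "is_svd M U s V \<longleftrightarrow>
     U \<in> carrier_mat (dim_row M) (dim_row M) \<and> U\<^sup>T * U = 1\<^sub>m (dim_row M) \<and>
     V \<in> carrier_mat (dim_col M) (dim_col M) \<and> V\<^sup>T * V = 1\<^sub>m (dim_col M) \<and>
     antimono s \<and> (\<forall>i. 0 \<le> s i) \<and> (\<forall>i \<ge> min (dim_row M) (dim_col M). s i = 0) \<and>
     M = U * mat (dim_row M) (dim_col M) (\<lambda>(i, j). if i = j then s i else 0) * V\<^sup>T"

(* The (i,j) block, counted from 0, of a matrix partitioned into blocks of size r x c. *)
definition mat_block :: "nat \<Rightarrow> nat \<Rightarrow> real mat \<Rightarrow> nat \<Rightarrow> nat \<Rightarrow> real mat" where
  "mat_block r c M i j = mat r c (\<lambda>(a, b). M $$ (i * r + a, j * c + b))"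

(* One shrinking step on a buffer B with 2l rows.  With indices from 0, s l is the (l+1)-st
   singular value.  Rows with index at least dim_col B belong to the padding zero singular
   values, for which there is no right singular vector. *)
definition fd_shrink :: "nat \<Rightarrow> real mat \<Rightarrow> real mat \<Rightarrow> bool" where
  "fd_shrink l B B' \<longleftrightarrow>
     (\<exists>U s V. is_svd B U s V \<and>
        B' = mat (2 * l) (dim_col B)
               (\<lambda>(j, c). if j < dim_col B then sqrt (max ((s j)\<^sup>2 - (s l)\<^sup>2) 0) * V $$ (c, j) else 0))"

(* spfd_buffer l d C i B: after i iterations of the loop the 2l x d buffer may be equal to B,
   where C 0, C 1, ... are the incoming l x d blocks.  This is a relation because singular value
   decompositions are not unique. *)
inductive spfd_buffer :: "nat \<Rightarrow> nat \<Rightarrow> (nat \<Rightarrow> real mat) \<Rightarrow> nat \<Rightarrow> real mat \<Rightarrow> bool"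
  for l d C where
  init: "spfd_buffer l d C 0 (C 0 @\<^sub>r 0\<^sub>m l d)"
| step: "spfd_buffer l d C i B \<Longrightarrow> fd_shrink l (mat_block l d B 0 0 @\<^sub>r C (Suc i)) B' \<Longrightarrow>
         spfd_buffer l d C (Suc i) B'"

(* B and At form a possible output of SpFD on input A: every choice of the singular value
   decompositions, of the orthonormal basis V and of the best rank-k approximation is allowed. *)
definition spfd_output ::
  "real mat \<Rightarrow> nat \<Rightarrow> nat \<Rightarrow> nat \<Rightarrow> real mat \<Rightarrow> real mat \<Rightarrow> real mat \<Rightarrow> real mat \<Rightarrow> bool" where
  "spfd_output A l k q S P B At \<longleftrightarrow>
     (let d = dim_col A; b = dim_row A div q;
          C = (\<lambda>i. mat_block l b S i i * mat_block b d (P * A) i 0)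
      in \<exists>B0 V r Y.
           spfd_buffer l d C (q - 1) B0 \<and>
           B = mat_block l d B0 0 0 \<and>
           V \<in> carrier_mat d r \<and> V\<^sup>T * V = 1\<^sub>m r \<and>
           vec_space.col_space d V = vec_space.row_space d B \<and>
           best_rank_approx k (A * V) Y \<and>
           At = Y * V\<^sup>T)"

(* The 0 and 1 passed to Pi_pmf are the irrelevant default values outside the index set. *)
definition spemb_pmf :: "nat \<Rightarrow> nat \<Rightarrow> real mat pmf" where
  "spemb_pmf l m =
     map_pmf (\<lambda>(h, s). mat l m (\<lambda>(i, j). if h j = i then 1 else 0) * mat_diag m s)
       (pair_pmf (Pi_pmf {..<m} 0 (\<lambda>_. pmf_of_set {..<l}))
                 (Pi_pmf {..<m} 1 (\<lambda>_. pmf_of_set {-1, 1})))"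

definition block_spemb_pmf :: "nat \<Rightarrow> nat \<Rightarrow> nat \<Rightarrow> real mat pmf" where
  "block_spemb_pmf q l m =
     map_pmf (\<lambda>Ss. diag_block_mat (map Ss [0..<q]))
       (Pi_pmf {..<q} (0\<^sub>m l m) (\<lambda>_. spemb_pmf l m))"

definition permutation_mats :: "nat \<Rightarrow> real mat set" where
  "permutation_mats n =
     {mat n n (\<lambda>(i, j). if i = p j then 1 else 0) | p. p permutes {..<n}}"

end

theory Submission
  imports Defs
begin

text \<open>
  Write \<open>|X|\<close> for the Frobenius norm, \<open>M = S P A\<close> for the stacked sketch and
  \<open>E = M\<^sup>T M - A\<^sup>T A\<close> for the error of its Gram matrix. The claim splits into a statement about
  every possible run of the algorithm and a second moment computation.

  Deterministic part. Shrinking by \<open>\<delta>\<^sub>i\<close> lowers every squared length \<open>|B x|\<^sup>2\<close> by at most \<open>\<delta>\<^sub>i |x|\<^sup>2\<close>,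
  and it lowers the \<open>l\<close> largest squared singular values by the full \<open>\<delta>\<^sub>i\<close>. Hence the final buffer satisfies
  \<open>|B N|\<^sup>2 \<le> |M N|\<^sup>2 \<le> |B N|\<^sup>2 + \<Delta> |N|\<^sup>2\<close> for all \<open>N\<close>, where \<open>\<Delta>\<close> is the sum of the \<open>\<delta>\<^sub>i\<close> and
  \<open>l \<Delta> \<le> |M|\<^sup>2\<close> (lemma \<open>spfd_buffer_bounds\<close>). To bound the error of the best approximation in the row
  space of \<open>B\<close> it is enough to exhibit one good candidate, and singular vectors of \<open>A\<close> or \<open>B\<close> are not
  needed for that. Let \<open>W\<close> be the orthogonal projection onto the row space of \<open>A\<^sub>k\<close>, and let \<open>U\<close> be the
  one onto the image of that space under the projection to the row space of \<open>B\<close>. Then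
  \<open>B W = B U W\<close>, so \<open>|B W| \<le> |B U|\<close>. Going from \<open>B\<close> to \<open>M\<close> costs at most \<open>k \<Delta>\<close>, and going from \<open>M\<close> to \<open>A\<close>
  costs the inner product of \<open>E\<close> with \<open>W - U\<close>, at most \<open>sqrt (2 k) |E|\<close>. Therefore \<open>A U\<close> has squared error
  at most \<open>|A - A\<^sub>k|\<^sup>2 + k \<Delta> + sqrt (2 k) |E|\<close> (lemma \<open>sketch_row_space_error\<close>). The equality in the
  theorem is a change of coordinates between the rows of \<open>B\<close> and an orthonormal basis of their span
  (lemma \<open>projected_error_eq_row_space_error\<close>).

  Random part. Because signs square to one, the entries of \<open>E\<close>, and also \<open>|M|\<^sup>2 - |A|\<^sup>2\<close>, are
  quadratic forms in the signs without diagonal terms, in which only pairs of rows that collide in a bucket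
  survive. Two different rows land in the same block with probability at most \<open>1 / q\<close> and are then
  hashed together with probability \<open>1 / l\<close>, so a form with weights \<open>w\<close> has second moment at most
  \<open>2 / (q l)\<close> times the sum of the \<open>w\<^sup>2\<close> (lemma \<open>total_chaos_second_moment\<close>). Consequently \<open>|E|\<^sup>2\<close> and
  \<open>(|M|\<^sup>2 - |A|\<^sup>2)\<^sup>2\<close> both have expectation at most \<open>2 |A|\<^sup>4 / (q l)\<close> (lemma \<open>gram_error_moments\<close>).

  Constants. If \<open>X = 8 k |E|\<^sup>2 / (\<epsilon>\<^sup>2 |A|\<^sup>4) + 4 (|M|\<^sup>2 - |A|\<^sup>2)\<^sup>2 / |A|\<^sup>4\<close> is below 1, then
  \<open>sqrt (2 k) |E| \<le> \<epsilon> |A|\<^sup>2 / 2\<close> and \<open>|M|\<^sup>2 \<le> 3 |A|\<^sup>2 / 2\<close>; since \<open>l \<ge> 3 k / \<epsilon>\<close>, also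
  \<open>k \<Delta> \<le> \<epsilon> |A|\<^sup>2 / 2\<close>. The expectation of \<open>X\<close> is at most
  \<open>(16 k + 8 \<epsilon>\<^sup>2) / (\<epsilon>\<^sup>2 q l)\<close>, which the lower bound on \<open>q l\<close> makes at most \<open>\<delta>\<close> because
  \<open>16 k + 8 \<le> 12 (k\<^sup>2 + k)\<close> for \<open>k \<ge> 1\<close>. Markov's inequality concludes.
\<close>

section \<open>The Frobenius inner product\<close>

definition frob_inner :: "real mat \<Rightarrow> real mat \<Rightarrow> real" where
  "frob_inner X Y = (\<Sum>i<dim_row X. \<Sum>j<dim_col X. X $$ (i, j) * Y $$ (i, j))"

abbreviation frob_sq :: "real mat \<Rightarrow> real" where
  "frob_sq X \<equiv> frob_inner X X"

text \<open>The inner dimension in the usual carrier premises of the product laws does not occur in the equation, so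
  rewriting cannot find it. With side conditions on \<open>dim_row\<close> and \<open>dim_col\<close> every premise is ground once
  the left-hand side has matched.\<close>

lemma mult_assoc_dims:
  fixes X Y Z :: "real mat"
  shows "dim_col X = dim_row Y \<Longrightarrow> dim_col Y = dim_row Z \<Longrightarrow> X * Y * Z = X * (Y * Z)"
  by (rule assoc_mult_mat[of _ "dim_row X" "dim_col X" _ "dim_col Y" _ "dim_col Z"]) auto

lemma transpose_mult_dims:
  fixes X Y :: "real mat"
  shows "dim_col X = dim_row Y \<Longrightarrow> (X * Y)\<^sup>T = Y\<^sup>T * X\<^sup>T"
  by (rule transpose_mult[of _ "dim_row X" "dim_col X" _ "dim_col Y"]) auto

lemma mult_entry:
  fixes X Y :: "real mat"
  assumes "i < dim_row X" "j < dim_col Y" "dim_col X = dim_row Y"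
  shows "(X * Y) $$ (i, j) = (\<Sum>k<dim_row Y. X $$ (i, k) * Y $$ (k, j))"
  using assms by (simp add: scalar_prod_def atLeast0LessThan)

lemma frob_norm_sq: "(frob_norm M)\<^sup>2 = frob_sq M"
  by (simp add: frob_norm_def frob_inner_def power2_eq_square sum_nonneg)

lemma frob_sq_nonneg: "0 \<le> frob_sq X"
  by (simp add: frob_inner_def sum_nonneg)

lemma frob_norm_le_iff: "frob_norm X \<le> frob_norm Y \<longleftrightarrow> frob_sq X \<le> frob_sq Y"
  unfolding frob_norm_sq[symmetric] frob_norm_def
  by (simp add: sum_nonneg)

lemma frob_inner_commute:
  "dim_row X = dim_row Y \<Longrightarrow> dim_col X = dim_col Y \<Longrightarrow> frob_inner X Y = frob_inner Y X"
  by (simp add: frob_inner_def mult.commute)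

lemma frob_inner_diff_left:
  "dim_row X = dim_row Y \<Longrightarrow> dim_col X = dim_col Y \<Longrightarrow>
   frob_inner (X - Y) Z = frob_inner X Z - frob_inner Y Z"
  by (simp add: frob_inner_def sum_subtractf[symmetric] algebra_simps)

lemma frob_inner_diff_right:
  "dim_row X = dim_row Z \<Longrightarrow> dim_col X = dim_col Z \<Longrightarrow> dim_row Y = dim_row Z \<Longrightarrow> dim_col Y = dim_col Z \<Longrightarrow>
   frob_inner Z (X - Y) = frob_inner Z X - frob_inner Z Y"
  by (simp add: frob_inner_def sum_subtractf[symmetric] algebra_simps)

lemma frob_sq_diff:
  "dim_row X = dim_row Y \<Longrightarrow> dim_col X = dim_col Y \<Longrightarrow>
   frob_sq (X - Y) = frob_sq X - 2 * frob_inner X Y + frob_sq Y"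
  by (simp add: frob_inner_diff_left frob_inner_diff_right frob_inner_commute[of Y X])

lemma frob_inner_mult_right:
  assumes "dim_col X = dim_row Y" "dim_row Z = dim_row X" "dim_col Z = dim_col Y"
  shows "frob_inner (X * Y) Z = frob_inner X (Z * Y\<^sup>T)"
proof -
  have "frob_inner (X * Y) Z =
      (\<Sum>i<dim_row X. \<Sum>j<dim_col Y. \<Sum>k<dim_row Y. X $$ (i,k) * Y $$ (k,j) * Z $$ (i,j))"
    unfolding frob_inner_def
    by (intro sum.cong) (auto simp: mult_entry assms sum_distrib_right simp del: index_mult_mat(1))
  also have "\<dots> = (\<Sum>i<dim_row X. \<Sum>k<dim_row Y. \<Sum>j<dim_col Y. X $$ (i,k) * Y $$ (k,j) * Z $$ (i,j))"
    by (intro sum.cong refl sum.swap)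
  also have "\<dots> = frob_inner X (Z * Y\<^sup>T)"
    unfolding frob_inner_def
    by (intro sum.cong) (auto simp: mult_entry assms sum_distrib_left mult_ac simp del: index_mult_mat(1))
  finally show ?thesis .
qed

lemma frob_inner_transpose:
  "dim_row X = dim_row Y \<Longrightarrow> dim_col X = dim_col Y \<Longrightarrow> frob_inner X\<^sup>T Y\<^sup>T = frob_inner X Y"
  unfolding frob_inner_def by (subst sum.swap) simp

lemma frob_inner_mult_left:
  assumes "dim_col X = dim_row Y" "dim_row Z = dim_row X" "dim_col Z = dim_col Y"
  shows "frob_inner (X * Y) Z = frob_inner Y (X\<^sup>T * Z)"
proof -
  have "frob_inner (X * Y) Z = frob_inner (Y\<^sup>T * X\<^sup>T) Z\<^sup>T"
    using frob_inner_transpose[of "X * Y" Z] assms by (simp add: transpose_mult_dims)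
  also have "\<dots> = frob_inner Y\<^sup>T (Z\<^sup>T * X)"
    by (subst frob_inner_mult_right) (use assms in auto)
  also have "\<dots> = frob_inner Y (X\<^sup>T * Z)"
    using frob_inner_transpose[of Y "X\<^sup>T * Z"] assms by (simp add: transpose_mult_dims)
  finally show ?thesis .
qed

lemma frob_Cauchy_Schwarz:
  assumes "dim_row X = dim_row Y" "dim_col X = dim_col Y"
  shows "\<bar>frob_inner X Y\<bar> \<le> frob_norm X * frob_norm Y"
proof -
  let ?I = "{..<dim_row X} \<times> {..<dim_col X}"
  have *: "frob_inner U V = (\<Sum>x\<in>?I. U $$ x * V $$ x)"
    if "dim_row U = dim_row X" "dim_col U = dim_col X" for U V
    using that by (simp add: frob_inner_def sum.cartesian_product)
  have "(frob_inner X Y)\<^sup>2 \<le> frob_sq X * frob_sq Y"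
    using Cauchy_Schwarz_ineq_sum[of "\<lambda>x. X $$ x" "\<lambda>x. Y $$ x" ?I] assms
    by (simp add: * power2_eq_square)
  also have "\<dots> = (frob_norm X * frob_norm Y)\<^sup>2"
    by (simp add: frob_norm_sq power_mult_distrib)
  finally show ?thesis
    by (rule abs_le_square_iff[THEN iffD2, of _ "frob_norm X * frob_norm Y", THEN order_trans])
       (simp add: frob_norm_def sum_nonneg)
qed

text \<open>The map \<open>Z \<mapsto> Z V\<^sup>T\<close> is an isometry onto the matrices with rows in the column space of \<open>V\<close>, and \<open>A V\<close> holds
  the coordinates of the projection of \<open>A\<close> to that space. Approximating \<open>A\<close> inside the space therefore
  amounts to approximating \<open>A V\<close>.\<close>

lemma Pythagoras_orthonormal_columns:
  assumes V: "V\<^sup>T * V = 1\<^sub>m (dim_col V)"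
    and d: "dim_col A = dim_row V" "dim_row Z = dim_row A" "dim_col Z = dim_col V"
  shows "frob_sq (A - Z * V\<^sup>T) = frob_sq A - frob_sq (A * V) + frob_sq (A * V - Z)"
proof -
  have "frob_sq (Z * V\<^sup>T) = frob_sq Z"
    using d V by (simp add: frob_inner_mult_right mult_assoc_dims right_mult_one_mat')
  moreover have "frob_inner A (Z * V\<^sup>T) = frob_inner (A * V) Z"
    using d by (simp add: frob_inner_mult_right)
  ultimately show ?thesis
    using d by (simp add: frob_sq_diff)
qed

text \<open>The rows of \<open>Z\<close> lie in the range of \<open>P\<close>, so \<open>A P - Z\<close> is orthogonal to \<open>A - A P\<close>.\<close>

lemma Pythagoras_projection:
  assumes P: "P\<^sup>T = P" "P * P = P"
    and d: "dim_col A = dim_row P" "dim_row Z = dim_row A" "dim_col Z = dim_row P" and Z: "Z * P = Z"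
  shows "frob_sq (A - Z) = frob_sq A - frob_sq (A * P) + frob_sq (A * P - Z)"
proof -
  have sq: "dim_col P = dim_row P"
    using P(1) by (metis index_transpose_mat(2))
  have "frob_inner A Z = frob_inner A (Z * P\<^sup>T)"
    using P(1) Z by simp
  also have "\<dots> = frob_inner (A * P) Z"
    using d sq by (simp add: frob_inner_mult_right)
  finally show ?thesis
    using d sq by (simp add: frob_sq_diff)
qed

lemma frob_sq_mult_projection_le:
  assumes P: "P\<^sup>T = P" "P * P = P" and d: "dim_col A = dim_row P"
  shows "frob_sq (A * P) \<le> frob_sq A"
proof -
  have sq: "dim_col P = dim_row P"
    using P(1) by (metis index_transpose_mat(2))
  have "frob_sq (A - A * P) = frob_sq A - frob_sq (A * P) + frob_sq (A * P - A * P)"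
    using P d sq by (intro Pythagoras_projection) (auto simp: mult_assoc_dims)
  moreover have "frob_sq (A * P - A * P) = 0"
    using d sq by (simp add: frob_sq_diff)
  ultimately show ?thesis
    using frob_sq_nonneg[of "A - A * P"] by simp
qed

section \<open>Rank factorizations and orthogonal projections\<close>

text \<open>A maximal independent set of columns serves as left factor. Together with the converse below, this turns
  a rank bound into a factorization through few inner dimensions, the only form in which rank is used from
  here on.\<close>

lemma rank_le_imp_factorization:
  fixes X :: "real mat"
  assumes X: "X \<in> carrier_mat a c" and k: "mat_rank X \<le> k"
  shows "\<exists>r\<le>k. \<exists>Y\<in>carrier_mat a r. \<exists>Z\<in>carrier_mat r c. X = Y * Z"
proof -
  interpret vec_space "TYPE(real)" a .
  have cols: "set (cols X) \<subseteq> carrier_vec a"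
    using X cols_dim by blast
  obtain S where S: "maximal S (\<lambda>T. T \<subseteq> set (cols X) \<and> lin_indpt T)"
    using maximal_exists[of "(\<lambda>T. T \<subseteq> set (cols X) \<and> lin_indpt T)" "card (set (cols X))" "{}"]
    by (meson List.finite_set card_mono empty_iff empty_subsetI finite_lin_indpt2 rev_finite_subset)
  have S': "S \<subseteq> set (cols X)" "lin_indpt S"
    using S by (auto simp: maximal_def)
  have "card S \<le> k"
    using rank_card_indpt[OF X S] k X by simp
  have in_span: "x \<in> span S" if x: "x \<in> set (cols X)" for x
  proof (rule ccontr)
    assume nx: "x \<notin> span S"
    have SC: "S \<subseteq> carrier_vec a" "x \<in> carrier_vec a"
      using S' cols x by auto
    have "lin_indpt (insert x S)"
      using lin_dep_iff_in_span[OF _ S'(2), of x] SC nx span_mem[of S x]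
      by auto
    then have "insert x S = S"
      using S x S' unfolding maximal_def by blast
    then show False
      using nx SC span_mem[of S x] by auto
  qed
  obtain xs where xs: "set xs = S" "length xs = card S"
    using S'(1) by (metis List.finite_set distinct_card finite_distinct_list rev_finite_subset)
  define Y where "Y = mat_of_cols a xs"
  have xsc: "set xs \<subseteq> carrier_vec a"
    using xs S' cols by auto
  have Y: "Y \<in> carrier_mat a (card S)" "cols Y = xs"
    using xs xsc by (auto simp: Y_def)
  have "\<forall>j<c. \<exists>x\<in>carrier_vec (card S). Y *\<^sub>v x = col X j"
  proof (intro allI impI)
    fix j assume j: "j < c"
    then have "col X j \<in> span S"
      using X by (intro in_span) (auto simp: cols_def)
    then have "col X j \<in> col_space Y"
      by (simp add: col_space_def Y xs)
    then show "\<exists>x\<in>carrier_vec (card S). Y *\<^sub>v x = col X j"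
      using col_space_eq[OF Y(1)] Y(1) by auto
  qed
  then obtain f where f: "\<And>j. j < c \<Longrightarrow> f j \<in> carrier_vec (card S) \<and> Y *\<^sub>v f j = col X j"
    by metis
  define Z where "Z = mat (card S) c (\<lambda>(i, j). f j $ i)"
  have Z: "Z \<in> carrier_mat (card S) c"
    by (simp add: Z_def)
  have colZ: "col Z j = f j" if "j < c" for j
    using f[OF that] that by (intro eq_vecI) (auto simp: Z_def)
  have "X = Y * Z"
  proof (rule mat_col_eqI)
    fix j assume "j < dim_col (Y * Z)"
    then have j: "j < c" using Z by simp
    show "col X j = col (Y * Z) j"
      using col_mult2[OF Y(1) Z j] f[OF j] colZ[OF j] by simp
  qed (use X Y Z in auto)
  then show ?thesis
    using \<open>card S \<le> k\<close> Y(1) Z by blast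
qed

lemma rank_mult_le_inner_dim:
  fixes Y Z :: "real mat"
  assumes Y: "Y \<in> carrier_mat a r" and Z: "Z \<in> carrier_mat r c"
  shows "mat_rank (Y * Z) \<le> r"
proof -
  interpret vec_space "TYPE(real)" a .
  define W where "W = span (set (cols Y))"
  define W' where "W' = span (set (cols (Y * Z)))"
  have YZ: "Y * Z \<in> carrier_mat a c" using Y Z by simp
  have colsY: "set (cols Y) \<subseteq> carrier_vec a" "set (cols (Y * Z)) \<subseteq> carrier_vec a"
    using Y YZ cols_dim by blast+
  have "set (cols (Y * Z)) \<subseteq> W"
  proof
    fix x assume "x \<in> set (cols (Y * Z))"
    then obtain j where j: "j < c" "x = col (Y * Z) j"
      using YZ by (auto simp: cols_def)
    then have "x = Y *\<^sub>v col Z j" "col Z j \<in> carrier_vec r"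
      using col_mult2[OF Y Z j(1)] Z by auto
    then have "x \<in> col_space Y"
      using col_space_eq[OF Y] Y by auto
    then show "x \<in> W"
      by (simp add: col_space_def W_def)
  qed
  then have "W' \<subseteq> W"
    unfolding W_def W'_def using colsY span_is_submodule span_is_subset by blast
  have sub: "subspace class_ring W V" "subspace class_ring W' V"
    unfolding W_def W'_def using colsY span_is_subspace by auto
  have fin: "vectorspace.fin_dim class_ring (vs W)" "vectorspace.fin_dim class_ring (vs W')"
    unfolding W_def W'_def using fin_dim_span_cols Y YZ by auto
  have "rank (Y * Z) \<le> rank Y"
    using vectorspace.subspace_dim[OF subspace_is_vs[OF sub(1)] nested_subspaces[OF sub \<open>W' \<subseteq> W\<close>] fin(1)] fin(2)
    by (simp add: rank_def W_def W'_def)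
  also have "\<dots> \<le> r"
    using rank_le_nc[OF Y] .
  finally show ?thesis using Y by simp
qed

lemma add_mult_dims:
  fixes X Y Z :: "real mat"
  shows "dim_row X = dim_row Y \<Longrightarrow> dim_col X = dim_col Y \<Longrightarrow> dim_col Y = dim_row Z \<Longrightarrow>
    (X + Y) * Z = X * Z + Y * Z"
  by (rule add_mult_distrib_mat[of _ "dim_row X" "dim_col X" _ _ "dim_col Z"]) auto

lemma mult_add_dims:
  fixes X Y Z :: "real mat"
  shows "dim_row X = dim_row Y \<Longrightarrow> dim_col X = dim_col Y \<Longrightarrow> dim_col Z = dim_row Y \<Longrightarrow>
    Z * (X + Y) = Z * X + Z * Y"
  by (rule mult_add_distrib_mat[of _ "dim_row Z" "dim_col Z" _ "dim_col X"]) auto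

lemma mult_minus_dims:
  fixes X Y Z :: "real mat"
  shows "dim_row X = dim_row Y \<Longrightarrow> dim_col X = dim_col Y \<Longrightarrow> dim_col Z = dim_row Y \<Longrightarrow>
    Z * (X - Y) = Z * X - Z * Y"
  by (rule mult_minus_distrib_mat[of _ "dim_row Z" "dim_col Z" _ "dim_col X"]) auto

lemma mult_smult_dims:
  fixes X Y :: "real mat"
  shows "dim_col X = dim_row Y \<Longrightarrow> X * (c \<cdot>\<^sub>m Y) = c \<cdot>\<^sub>m (X * Y)"
  by (rule mult_smult_distrib[of _ "dim_row X" "dim_col X" _ "dim_col Y"]) auto

lemma zero_mult_dims: "dim_row Y = b \<Longrightarrow> 0\<^sub>m a b * Y = (0\<^sub>m a (dim_col Y) :: real mat)"
  by (rule left_mult_zero_mat) auto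

lemma mult_zero_dims: "dim_col X = b \<Longrightarrow> X * 0\<^sub>m b c = (0\<^sub>m (dim_row X) c :: real mat)"
  by (rule right_mult_zero_mat) auto

lemma frob_sq_eq_0D:
  assumes "frob_sq X = 0"
  shows "X = 0\<^sub>m (dim_row X) (dim_col X)"
proof (rule eq_matI)
  fix i j assume ij: "i < dim_row (0\<^sub>m (dim_row X) (dim_col X) :: real mat)" "j < dim_col (0\<^sub>m (dim_row X) (dim_col X) :: real mat)"
  have "\<forall>i<dim_row X. (\<Sum>j<dim_col X. X $$ (i, j) * X $$ (i, j)) = 0"
    using assms unfolding frob_inner_def
    by (subst (asm) sum_nonneg_eq_0_iff) (auto simp: sum_nonneg)
  then have "\<forall>i<dim_row X. \<forall>j<dim_col X. X $$ (i, j) * X $$ (i, j) = 0"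
    by (auto simp: sum_nonneg_eq_0_iff)
  then show "X $$ (i, j) = 0\<^sub>m (dim_row X) (dim_col X) $$ (i, j)"
    using ij by auto
qed auto

text \<open>\<open>P\<close> and \<open>w w\<^sup>T\<close> are orthogonal projections with orthogonal ranges, so their sum is again one; its squared
  norm, which is its rank, grows by one.\<close>

lemma projection_adjoin:
  assumes P: "P \<in> carrier_mat d d" "P\<^sup>T = P" "P * P = P"
    and w: "w \<in> carrier_mat d 1" "w\<^sup>T * w = 1\<^sub>m 1" "P * w = 0\<^sub>m d 1"
  defines "P' \<equiv> P + w * w\<^sup>T"
  shows "P'\<^sup>T = P'" "P' * P' = P'" "frob_sq P' = frob_sq P + 1" "P' * w = w"
    and "\<And>x. x \<in> carrier_mat d 1 \<Longrightarrow> P * x = x \<Longrightarrow> P' * x = x"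
proof -
  note [simp] = carrier_matD[OF P(1)] carrier_matD[OF w(1)]
  have wP: "w\<^sup>T * P = 0\<^sub>m 1 d"
    using arg_cong[OF w(3), of transpose_mat] P(2) by (simp add: transpose_mult_dims)
  have w2: "w\<^sup>T * (P * y) = 0\<^sub>m 1 (dim_col y)" if "dim_row y = d" for y
    using that wP by (subst mult_assoc_dims[symmetric]) (simp_all add: zero_mult_dims)
  show "P'\<^sup>T = P'"
    unfolding P'_def using P by (subst transpose_add[of _ d d]) (auto simp: transpose_mult_dims intro: carrier_matI)
  show Pw: "P' * w = w"
    unfolding P'_def using w by (simp add: add_mult_dims mult_assoc_dims right_mult_one_mat')
  show "P' * x = x" if x: "x \<in> carrier_mat d 1" "P * x = x" for x
  proof -
    have "w\<^sup>T * x = 0\<^sub>m 1 1" using w2[of x] x by simp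
    then show ?thesis
      using x unfolding P'_def by (simp add: add_mult_dims mult_assoc_dims mult_zero_dims)
  qed
  have "P' * P = P"
    unfolding P'_def using P wP by (simp add: add_mult_dims mult_assoc_dims mult_zero_dims)
  moreover have "P' * (w * w\<^sup>T) = w * w\<^sup>T"
    using Pw P by (subst mult_assoc_dims[symmetric]) (auto simp: P'_def)
  ultimately show "P' * P' = P'"
    by (metis P'_def P(1) w(1) mult_add_distrib_mat add_carrier_mat mult_carrier_mat transpose_carrier_mat)
  have "frob_inner P (w * w\<^sup>T) = frob_inner (P * w) w"
    by (simp add: frob_inner_mult_right)
  also have "\<dots> = 0" using w by (simp add: frob_inner_def)
  finally have 0: "frob_inner P (w * w\<^sup>T) = 0" .
  have "frob_inner w w = (w\<^sup>T * w) $$ (0,0)"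
    by (simp add: frob_inner_def mult_entry del: index_mult_mat(1))
  then have "frob_inner w w = 1" using w by simp
  then have 1: "frob_sq (w * w\<^sup>T) = 1"
    using w by (simp add: frob_inner_mult_right mult_assoc_dims right_mult_one_mat')
  have "frob_sq P' = frob_sq P + 2 * frob_inner P (w * w\<^sup>T) + frob_sq (w * w\<^sup>T)"
    unfolding P'_def frob_inner_def by (simp add: algebra_simps sum.distrib sum_distrib_left)
  then show "frob_sq P' = frob_sq P + 1" using 0 1 by simp
qed

text \<open>This is Gram-Schmidt on the columns of \<open>T\<close> that keeps only the projection \<open>P\<close> to the span of the columns
  treated so far: a column \<open>t\<close> that \<open>P\<close> does not fix contributes the normalized residual \<open>t - P t\<close>. The
  factor \<open>K\<close> records that the range of \<open>P\<close> stays inside the column space of \<open>T\<close>, and the bound on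
  \<open>frob_sq P\<close> is a bound on its rank. Since \<open>K\<close> has \<open>r\<close> rows from the start, the induction over the columns
  never changes the shape of a matrix.\<close>

lemma orthogonal_projection_exists:
  assumes T: "T \<in> carrier_mat d r"
  shows "\<exists>P\<in>carrier_mat d d. \<exists>K\<in>carrier_mat r d.
     P\<^sup>T = P \<and> P * P = P \<and> P * T = T \<and> P = T * K \<and> frob_sq P \<le> real r"
proof -
  define e :: "nat \<Rightarrow> real mat" where "e i = mat r 1 (\<lambda>(x, _). if x = i then 1 else 0)" for i
  note [simp] = carrier_matD[OF T]
  have e[simp]: "dim_row (e i) = r" "dim_col (e i) = 1" for i
    by (auto simp: e_def)
  have col: "(X * e i) $$ (x, 0) = X $$ (x, i)" if "X \<in> carrier_mat d r" "i < r" "x < d" for X i x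
    using that by (simp add: mult_entry e_def if_distrib[of "\<lambda>y. _ * y"] sum.delta cong: if_cong del: index_mult_mat(1))
  have "\<exists>P\<in>carrier_mat d d. \<exists>K\<in>carrier_mat r d.
     P\<^sup>T = P \<and> P * P = P \<and> P = T * K \<and> frob_sq P \<le> real j \<and> (\<forall>i<j. P * (T * e i) = T * e i)"
    if "j \<le> r" for j
    using that
  proof (induction j)
    case 0
    show ?case
      by (rule bexI[of _ "0\<^sub>m d d"], rule bexI[of _ "0\<^sub>m r d"])
         (auto simp: frob_inner_def zero_mult_dims mult_zero_dims)
  next
    case (Suc j)
    have "j \<le> r" using Suc.prems by simp
    from Suc.IH[OF this] obtain P K where P: "P \<in> carrier_mat d d" "P\<^sup>T = P" "P * P = P" and K: "K \<in> carrier_mat r d" "P = T * K"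
      and sz: "frob_sq P \<le> real j" and fx: "\<forall>i<j. P * (T * e i) = T * e i"
      by blast
    note [simp] = carrier_matD[OF P(1)] carrier_matD[OF K(1)]
    define t where "t = T * e j"
    define k where "k = e j - K * t"
    define w where "w = T * k"
    have [simp]: "dim_row t = d" "dim_col t = 1" "dim_row k = r" "dim_col k = 1" "dim_row w = d" "dim_col w = 1"
      by (auto simp: t_def k_def w_def)
    have w: "w = t - P * t"
      unfolding w_def k_def by (subst mult_minus_dims) (auto simp: t_def K(2) mult_assoc_dims)
    have PPt: "P * (P * t) = P * t"
      using P(3) by (subst mult_assoc_dims[symmetric]) simp_all
    then have Pw: "P * w = 0\<^sub>m d 1"
      unfolding w by (subst mult_minus_dims) auto
    have t: "t = P * t + w"
      unfolding w by (intro eq_matI) auto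
    show ?case
    proof (cases "frob_sq w = 0")
      case True
      then have "w = 0\<^sub>m d 1" using frob_sq_eq_0D[of w] by simp
      then have "P * t = t" using t by (metis P(1) \<open>dim_col t = 1\<close> \<open>dim_row t = d\<close> carrier_matI mult_carrier_mat right_add_zero_mat)
      then have "\<forall>i<Suc j. P * (T * e i) = T * e i" using fx by (metis t_def less_Suc_eq)
      moreover have "frob_sq P \<le> real (Suc j)" using sz by simp
      ultimately show ?thesis using P K by blast
    next
      case False
      define \<alpha> where "\<alpha> = sqrt (frob_sq w)"
      have \<alpha>: "\<alpha> \<noteq> 0" "\<alpha> * \<alpha> = frob_sq w"
        using False frob_sq_nonneg[of w] by (auto simp: \<alpha>_def)
      define u where "u = (1 / \<alpha>) \<cdot>\<^sub>m w"
      have [simp]: "dim_row u = d" "dim_col u = 1" by (auto simp: u_def)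
      have "(u\<^sup>T * u) $$ (0, 0) = frob_sq u"
        by (simp add: frob_inner_def mult_entry del: index_mult_mat(1))
      also have "\<dots> = frob_sq w / (\<alpha> * \<alpha>)"
        by (simp add: frob_inner_def u_def sum_divide_distrib)
      also have "\<dots> = 1" using \<alpha> False by simp
      finally have uu: "u\<^sup>T * u = 1\<^sub>m 1"
        by (intro eq_matI) auto
      have Pu: "P * u = 0\<^sub>m d 1"
        using Pw by (auto simp: u_def mult_smult_dims)
      have uc: "u \<in> carrier_mat d 1" by (rule carrier_matI) auto
      define P' where "P' = P + u * u\<^sup>T"
      note adj = projection_adjoin[OF P uc uu Pu, folded P'_def]
      have P': "P' \<in> carrier_mat d d" by (simp add: P'_def carrier_matI)
      define K' where "K' = K + (1 / \<alpha>) \<cdot>\<^sub>m k * u\<^sup>T"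
      have K': "K' \<in> carrier_mat r d" by (simp add: K'_def carrier_matI)
      have "u = T * ((1 / \<alpha>) \<cdot>\<^sub>m k)" by (simp add: u_def w_def mult_smult_dims)
      then have PK: "P' = T * K'"
        unfolding P'_def K'_def K(2) by (simp add: mult_add_dims mult_assoc_dims)
      have wu: "w = \<alpha> \<cdot>\<^sub>m u" unfolding u_def using \<alpha> by (intro eq_matI) auto
      have Ptc: "P * t \<in> carrier_mat d 1" by (rule carrier_matI) auto
      have "P' * (P * t) = P * t"
        by (intro adj(5) Ptc PPt)
      moreover have "P' * w = w"
        unfolding wu using adj(4) P' by (simp add: mult_smult_dims)
      ultimately have "P' * t = t"
        using P' t mult_add_dims[of "P * t" w P'] by simp
      moreover have "P' * (T * e i) = T * e i" if "i < j" for i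
        using fx that by (intro adj(5)) (auto intro!: carrier_matI)
      ultimately have "\<forall>i<Suc j. P' * (T * e i) = T * e i"
        by (metis t_def less_Suc_eq)
      moreover have "frob_sq P' \<le> real (Suc j)" using sz adj(3) by simp
      ultimately show ?thesis
        using P' K' PK adj(1,2) by blast
    qed
  qed
  from this[OF order_refl] obtain P K where P: "P \<in> carrier_mat d d" "P\<^sup>T = P" "P * P = P" and K: "K \<in> carrier_mat r d" "P = T * K"
      and sz: "frob_sq P \<le> real r" and fx: "\<forall>i<r. P * (T * e i) = T * e i"
    by blast
  have "P * T = T"
  proof (rule eq_matI)
    fix x i assume xi: "x < dim_row T" "i < dim_col T"
    have "(P * T) $$ (x, i) = (P * T * e i) $$ (x, 0)"
      using xi P(1) T by (subst col) auto
    also have "\<dots> = (T * e i) $$ (x, 0)"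
      using fx xi P(1) by (simp add: mult_assoc_dims)
    also have "\<dots> = T $$ (x, i)"
      using xi T by (subst col) auto
    finally show "(P * T) $$ (x, i) = T $$ (x, i)" .
  qed (use P in auto)
  then show ?thesis using P K sz by blast
qed

section \<open>Frequent directions as a two-sided bound\<close>

lemma sum_lessThan_add:
  fixes f :: "nat \<Rightarrow> real"
  shows "(\<Sum>i<a + b. f i) = (\<Sum>i<a. f i) + (\<Sum>i<b. f (a + i))"
  by (induction b) (auto simp: add.assoc)

lemma sum_lessThan_mult:
  fixes f :: "nat \<Rightarrow> real"
  shows "(\<Sum>x<q * l. f x) = (\<Sum>i<q. \<Sum>a<l. f (i * l + a))"
proof (induction q)
  case (Suc q)
  have "(\<Sum>x<Suc q * l. f x) = (\<Sum>x<q * l + l. f x)" by (simp add: add.commute)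
  then show ?case using Suc by (simp add: sum_lessThan_add)
qed simp

definition row_sq :: "real mat \<Rightarrow> nat \<Rightarrow> real" where
  "row_sq X i = (\<Sum>j<dim_col X. (X $$ (i, j))\<^sup>2)"

lemma frob_sq_rows: "frob_sq X = (\<Sum>i<dim_row X. row_sq X i)"
  by (simp add: frob_inner_def row_sq_def power2_eq_square)

lemma row_sq_nonneg: "0 \<le> row_sq X i"
  by (simp add: row_sq_def sum_nonneg)

lemma row_sq_mult_cong:
  fixes X Y N :: "real mat"
  assumes "i < dim_row X" "i' < dim_row Y" "dim_col X = dim_row N" "dim_col Y = dim_row N"
    and "\<And>j. j < dim_row N \<Longrightarrow> X $$ (i, j) = Y $$ (i', j)"
  shows "row_sq (X * N) i = row_sq (Y * N) i'"
  unfolding row_sq_def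
  by (intro sum.cong) (use assms in \<open>auto simp: mult_entry simp del: index_mult_mat(1)\<close>)

lemma frob_sq_append_rows_mult:
  assumes "X \<in> carrier_mat a d" "Y \<in> carrier_mat b d" "N \<in> carrier_mat d c"
  shows "frob_sq ((X @\<^sub>r Y) * N) = frob_sq (X * N) + frob_sq (Y * N)"
proof -
  have 1: "row_sq ((X @\<^sub>r Y) * N) i = row_sq (X * N) i" if "i < a" for i
    using assms that by (intro row_sq_mult_cong) (auto simp: append_rows_def)
  have 2: "row_sq ((X @\<^sub>r Y) * N) (a + i) = row_sq (Y * N) i" if "i < b" for i
    using assms that by (intro row_sq_mult_cong) (auto simp: append_rows_def)
  have "dim_row (X @\<^sub>r Y) = a + b" using assms by (auto simp: append_rows_def)
  then show ?thesis
    using assms 1 2 by (simp add: frob_sq_rows sum_lessThan_add)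
qed

lemma frob_sq_top_block_mult:
  assumes B: "B \<in> carrier_mat (2 * l) d" and zero: "\<And>i j. l \<le> i \<Longrightarrow> i < 2 * l \<Longrightarrow> j < d \<Longrightarrow> B $$ (i, j) = 0"
    and N: "N \<in> carrier_mat d c"
  shows "frob_sq (mat_block l d B 0 0 * N) = frob_sq (B * N)"
proof -
  have 1: "row_sq (mat_block l d B 0 0 * N) i = row_sq (B * N) i" if "i < l" for i
    using assms that by (intro row_sq_mult_cong) (auto simp: mat_block_def)
  have 2: "row_sq (B * N) (l + i) = 0" if "i < l" for i
    unfolding row_sq_def using assms that
    by (auto simp: mult_entry simp del: index_mult_mat(1) intro!: sum.neutral)
  have d: "dim_row (mat_block l d B 0 0) = l" "dim_row B = l + l" using B by (auto simp: mat_block_def)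
  show ?thesis
    using 1 2 by (simp add: frob_sq_rows d sum_lessThan_add)
qed

definition stacked :: "nat \<Rightarrow> nat \<Rightarrow> nat \<Rightarrow> (nat \<Rightarrow> real mat) \<Rightarrow> real mat" where
  "stacked q l d C = mat (q * l) d (\<lambda>(x, u). C (x div l) $$ (x mod l, u))"

lemma block_index_less:
  fixes i a q m :: nat
  assumes "i < q" "a < m"
  shows "i * m + a < q * m"
proof -
  have "i * m + a < Suc i * m" using assms by simp
  also have "\<dots> \<le> q * m" using assms by (intro mult_right_mono) auto
  finally show ?thesis .
qed

lemma stacked_entry:
  assumes "i < q" "a < l" "u < d"
  shows "stacked q l d C $$ (i * l + a, u) = C i $$ (a, u)"
  using block_index_less[OF assms(1,2)] assms by (simp add: stacked_def)

lemma frob_sq_stacked_mult: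
  assumes C: "\<And>i. i < q \<Longrightarrow> C i \<in> carrier_mat l d" and N: "N \<in> carrier_mat d c"
  shows "frob_sq (stacked q l d C * N) = (\<Sum>i<q. frob_sq (C i * N))"
proof -
  have M: "dim_row (stacked q l d C) = q * l" "dim_col (stacked q l d C) = d"
    by (simp_all add: stacked_def)
  have "row_sq (stacked q l d C * N) (i * l + a) = row_sq (C i * N) a" if "i < q" "a < l" for i a
    using C[of i] N block_index_less[OF that] that stacked_entry[OF that]
    by (intro row_sq_mult_cong) (auto simp: M)
  moreover have "dim_row (C i) = l" if "i < q" for i using C[OF that] by auto
  ultimately show ?thesis
    by (simp add: frob_sq_rows sum_lessThan_mult M)
qed

lemma frob_sq_diag_mult:
  assumes Y: "Y \<in> carrier_mat d c"
  shows "frob_sq (mat r d (\<lambda>(i, j). if i = j then f i else 0) * Y) = (\<Sum>j<min r d. (f j)\<^sup>2 * row_sq Y j)"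
    (is "frob_sq (?D * Y) = _")
proof -
  have "row_sq (?D * Y) i = (if i < d then (f i)\<^sup>2 * row_sq Y i else 0)" if "i < r" for i
  proof -
    have "(?D * Y) $$ (i, j) = (if i < d then f i * Y $$ (i, j) else 0)" if "j < c" for j
    proof -
      have "(?D * Y) $$ (i, j) = (\<Sum>k<d. (if i = k then f i else 0) * Y $$ (k, j))"
        using that \<open>i < r\<close> Y by (subst mult_entry) auto
      also have "\<dots> = (\<Sum>k<d. if i = k then f i * Y $$ (k, j) else 0)"
        by (intro sum.cong) auto
      finally show ?thesis by (simp add: sum.delta)
    qed
    then show ?thesis
      using Y by (simp add: row_sq_def power_mult_distrib sum_distrib_left del: index_mult_mat(1))
  qed
  then have "frob_sq (?D * Y) = (\<Sum>i<r. if i < d then (f i)\<^sup>2 * row_sq Y i else 0)"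
    by (simp add: frob_sq_rows)
  also have "\<dots> = (\<Sum>j<min r d. (f j)\<^sup>2 * row_sq Y j)"
    by (intro sum.mono_neutral_cong_right) auto
  finally show ?thesis .
qed

lemma frob_sq_isometry_mult:
  assumes U: "U\<^sup>T * U = 1\<^sub>m (dim_col U)" and d: "dim_col U = dim_row N"
  shows "frob_sq (U * N) = frob_sq N"
proof -
  have "U\<^sup>T * (U * N) = N"
    using U d by (subst mult_assoc_dims[symmetric]) (simp_all add: left_mult_one_mat')
  then show ?thesis
    using d by (simp add: frob_inner_mult_left)
qed

text \<open>In the coordinates \<open>V\<^sup>T N\<close> the step replaces the weights \<open>s\<^sub>j\<^sup>2\<close> by \<open>max (s\<^sub>j\<^sup>2 - \<eta>) 0\<close> with
  \<open>\<eta> = s\<^sub>l\<^sup>2\<close>. No weight falls by more than \<open>\<eta>\<close>, which gives the two-sided bound. The weights with \<open>j < l\<close> fall by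
  exactly \<open>\<eta>\<close>, which makes every unit of \<open>\<eta>\<close> cost \<open>l\<close> units of squared Frobenius norm; if \<open>d \<le> l\<close>, then \<open>s\<^sub>l\<close>
  is a padding zero and nothing is shrunk.\<close>

lemma fd_shrink_bounds:
  assumes shrink: "fd_shrink l B B'" and B: "B \<in> carrier_mat (2 * l) d"
  shows "\<exists>\<eta>\<ge>0. B' \<in> carrier_mat (2 * l) d \<and>
      (\<forall>i j. l \<le> i \<longrightarrow> i < 2 * l \<longrightarrow> j < d \<longrightarrow> B' $$ (i, j) = 0) \<and>
      (\<forall>c. \<forall>N\<in>carrier_mat d c. frob_sq (B' * N) \<le> frob_sq (B * N) \<and>
          frob_sq (B * N) \<le> frob_sq (B' * N) + \<eta> * frob_sq N) \<and>
      frob_sq B' + real l * \<eta> \<le> frob_sq B"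
proof -
  obtain U s V where svd: "is_svd B U s V" and
    B': "B' = mat (2 * l) d (\<lambda>(j, c). if j < d then sqrt (max ((s j)\<^sup>2 - (s l)\<^sup>2) 0) * V $$ (c, j) else 0)"
    using shrink B by (auto simp: fd_shrink_def)
  define \<eta> where "\<eta> = (s l)\<^sup>2"
  define g where "g j = sqrt (max ((s j)\<^sup>2 - \<eta>) 0)" for j
  define S where "S = mat (2 * l) d (\<lambda>(i, j). if i = j then s i else 0)"
  have U: "U \<in> carrier_mat (2 * l) (2 * l)" "U\<^sup>T * U = 1\<^sub>m (2 * l)" and V: "V \<in> carrier_mat d d" "V\<^sup>T * V = 1\<^sub>m d"
    and s: "antimono s" "\<And>i. 0 \<le> s i" "\<And>i. min (2 * l) d \<le> i \<Longrightarrow> s i = 0" and BS: "B = U * S * V\<^sup>T"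
    using svd B unfolding is_svd_def S_def by auto
  have VV: "V * V\<^sup>T = 1\<^sub>m d"
    using mat_mult_left_right_inverse[of "V\<^sup>T" d V] V by simp
  note [simp] = carrier_matD[OF U(1)] carrier_matD[OF V(1)]
  have [simp]: "dim_row S = 2 * l" "dim_col S = d" by (auto simp: S_def)
  have s_le: "(s j)\<^sup>2 \<le> (s i)\<^sup>2" if "i \<le> j" for i j
    using s(1,2) that by (intro power_mono) (auto simp: antimono_def)
  have g0: "g j = 0" if "l \<le> j" for j
    using s_le[OF that] by (simp add: g_def \<eta>_def)
  have g2: "(g j)\<^sup>2 = max ((s j)\<^sup>2 - \<eta>) 0" for j
    by (simp add: g_def)
  have B'D: "B' = mat (2 * l) d (\<lambda>(i, j). if i = j then g i else 0) * V\<^sup>T" (is "_ = ?D * _")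
  proof (rule eq_matI)
    fix i c assume "i < dim_row (?D * V\<^sup>T)" "c < dim_col (?D * V\<^sup>T)"
    then have ic: "i < 2 * l" "c < d" by auto
    have "(?D * V\<^sup>T) $$ (i, c) = (\<Sum>k<d. (if i = k then g i else 0) * V $$ (c, k))"
      using ic by (subst mult_entry) auto
    also have "\<dots> = (\<Sum>k<d. if i = k then g i * V $$ (c, k) else 0)"
      by (intro sum.cong) auto
    also have "\<dots> = (if i < d then g i * V $$ (c, i) else 0)" by (simp add: sum.delta)
    finally show "B' $$ (i, c) = (?D * V\<^sup>T) $$ (i, c)"
      using ic by (simp add: B' g_def \<eta>_def del: index_mult_mat(1))
  qed (auto simp: B')
  have mB: "frob_sq (B * N) = (\<Sum>j<d. (s j)\<^sup>2 * row_sq (V\<^sup>T * N) j)"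
    and mB': "frob_sq (B' * N) = (\<Sum>j<d. (g j)\<^sup>2 * row_sq (V\<^sup>T * N) j)"
    and mN: "frob_sq N = (\<Sum>j<d. row_sq (V\<^sup>T * N) j)"
    if N: "N \<in> carrier_mat d c" for N c
  proof -
    note [simp] = carrier_matD[OF N]
    have VN: "V\<^sup>T * N \<in> carrier_mat d c" by (rule carrier_matI) auto
    have "B * N = U * (S * (V\<^sup>T * N))"
      by (simp add: BS mult_assoc_dims)
    then have "frob_sq (B * N) = frob_sq (S * (V\<^sup>T * N))"
      using U by (simp add: frob_sq_isometry_mult)
    also have "\<dots> = (\<Sum>j<min (2 * l) d. (s j)\<^sup>2 * row_sq (V\<^sup>T * N) j)"
      unfolding S_def by (rule frob_sq_diag_mult[OF VN])
    also have "\<dots> = (\<Sum>j<d. (s j)\<^sup>2 * row_sq (V\<^sup>T * N) j)"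
      by (intro sum.mono_neutral_left) (use s(3) in auto)
    finally show "frob_sq (B * N) = (\<Sum>j<d. (s j)\<^sup>2 * row_sq (V\<^sup>T * N) j)" .
    have "B' * N = ?D * (V\<^sup>T * N)"
      by (simp add: B'D mult_assoc_dims)
    then have "frob_sq (B' * N) = (\<Sum>j<min (2 * l) d. (g j)\<^sup>2 * row_sq (V\<^sup>T * N) j)"
      using frob_sq_diag_mult[OF VN] by simp
    also have "\<dots> = (\<Sum>j<d. (g j)\<^sup>2 * row_sq (V\<^sup>T * N) j)"
      by (intro sum.mono_neutral_left) (use g0 in auto)
    finally show "frob_sq (B' * N) = (\<Sum>j<d. (g j)\<^sup>2 * row_sq (V\<^sup>T * N) j)" .
    have "frob_sq N = frob_sq (V\<^sup>T * N)"
      using frob_sq_isometry_mult[of "V\<^sup>T" N] VV by simp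
    then show "frob_sq N = (\<Sum>j<d. row_sq (V\<^sup>T * N) j)"
      by (simp add: frob_sq_rows)
  qed
  have row1: "row_sq (V\<^sup>T * 1\<^sub>m d) j = 1" if "j < d" for j
  proof -
    have "row_sq (V\<^sup>T * 1\<^sub>m d) j = (V\<^sup>T * V) $$ (j, j)"
      using that by (subst mult_entry) (auto simp: row_sq_def power2_eq_square right_mult_one_mat')
    then show ?thesis using V(2) that by simp
  qed
  have c1: "1\<^sub>m d \<in> carrier_mat d d" by simp
  have B'c: "B' \<in> carrier_mat (2 * l) d" by (auto simp: B')
  have "frob_sq B = (\<Sum>j<d. (s j)\<^sup>2)" "frob_sq B' = (\<Sum>j<d. (g j)\<^sup>2)"
    using mB[OF c1] mB'[OF c1] row1 B B'c by (simp_all add: right_mult_one_mat')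
  moreover have "(\<Sum>j<d. (g j)\<^sup>2) + real l * \<eta> \<le> (\<Sum>j<d. (s j)\<^sup>2)"
  proof (cases "l < d")
    case True
    have "real l * \<eta> = (\<Sum>j<d. if j < l then \<eta> else 0)"
      using True by (subst sum.mono_neutral_cong_right[of "{..<d}" "{..<l}" _ "\<lambda>_. \<eta>"]) auto
    also have "\<dots> \<le> (\<Sum>j<d. (s j)\<^sup>2 - (g j)\<^sup>2)"
    proof (intro sum_mono)
      fix j
      show "(if j < l then \<eta> else 0) \<le> (s j)\<^sup>2 - (g j)\<^sup>2"
        using s_le[of j l] by (auto simp: g2 \<eta>_def max_def)
    qed
    finally show ?thesis by (simp add: sum_subtractf)
  next
    case False
    then have "\<eta> = 0" using s(3)[of l] by (simp add: \<eta>_def)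
    then show ?thesis by (simp add: g2)
  qed
  ultimately have tr: "frob_sq B' + real l * \<eta> \<le> frob_sq B" by simp
  have "frob_sq (B' * N) \<le> frob_sq (B * N)" "frob_sq (B * N) \<le> frob_sq (B' * N) + \<eta> * frob_sq N"
    if N: "N \<in> carrier_mat d c" for N c
  proof -
    show "frob_sq (B' * N) \<le> frob_sq (B * N)"
      unfolding mB[OF N] mB'[OF N] by (intro sum_mono mult_right_mono row_sq_nonneg) (auto simp: g2 \<eta>_def)
    have "(\<Sum>j<d. (s j)\<^sup>2 * row_sq (V\<^sup>T * N) j) \<le> (\<Sum>j<d. ((g j)\<^sup>2 + \<eta>) * row_sq (V\<^sup>T * N) j)"
      by (intro sum_mono mult_right_mono row_sq_nonneg) (auto simp: g2)
    then show "frob_sq (B * N) \<le> frob_sq (B' * N) + \<eta> * frob_sq N"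
      unfolding mB[OF N] mB'[OF N] mN[OF N] by (simp add: sum_distrib_left distrib_right sum.distrib)
  qed
  moreover have "\<forall>i j. l \<le> i \<longrightarrow> i < 2 * l \<longrightarrow> j < d \<longrightarrow> B' $$ (i, j) = 0"
    using g0 by (auto simp: B' g_def \<eta>_def)
  moreover have "0 \<le> \<eta>" by (simp add: \<eta>_def)
  ultimately show ?thesis
    using tr B'c by blast
qed

text \<open>The bounds of the single steps add up, with \<open>\<Delta>\<close> the sum of their \<open>\<eta>\<close>; the norms telescope because
  every incoming block enters the buffer with its full squared norm.\<close>

lemma spfd_buffer_bounds:
  assumes buf: "spfd_buffer l d C i B" and C: "\<And>j. C j \<in> carrier_mat l d"
  shows "\<exists>\<Delta>\<ge>0. B \<in> carrier_mat (2 * l) d \<and>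
      (\<forall>i j. l \<le> i \<longrightarrow> i < 2 * l \<longrightarrow> j < d \<longrightarrow> B $$ (i, j) = 0) \<and>
      (\<forall>c. \<forall>N\<in>carrier_mat d c. frob_sq (B * N) \<le> (\<Sum>j\<le>i. frob_sq (C j * N)) \<and>
          (\<Sum>j\<le>i. frob_sq (C j * N)) \<le> frob_sq (B * N) + \<Delta> * frob_sq N) \<and>
      frob_sq B + real l * \<Delta> \<le> (\<Sum>j\<le>i. frob_sq (C j))"
  using buf
proof (induction rule: spfd_buffer.induct)
  case init
  have c: "C 0 @\<^sub>r 0\<^sub>m l d \<in> carrier_mat (2 * l) d"
    using carrier_append_rows[OF C[of 0], of "0\<^sub>m l d" l] by (simp add: mult_2)
  have eq: "frob_sq ((C 0 @\<^sub>r 0\<^sub>m l d) * N) = frob_sq (C 0 * N)" if "N \<in> carrier_mat d c" for N c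
    using frob_sq_append_rows_mult[OF C[of 0] zero_carrier_mat that, of l] that
    by (simp add: left_mult_zero_mat[OF that] frob_inner_def)
  have eq1: "frob_sq (C 0 @\<^sub>r 0\<^sub>m l d) = frob_sq (C 0)"
    using eq[of "1\<^sub>m d" d] c C[of 0] by (simp add: right_mult_one_mat')
  have z: "(C 0 @\<^sub>r 0\<^sub>m l d) $$ (i, j) = 0" if "l \<le> i" "i < 2 * l" "j < d" for i j
    using C[of 0] that by (auto simp: append_rows_def)
  show ?case
    by (rule exI[of _ 0]) (use c eq eq1 z in auto)
next
  case (step i B B')
  from step.IH obtain \<Delta> where D: "0 \<le> \<Delta>" and B: "B \<in> carrier_mat (2 * l) d"
    and z: "\<And>i j. l \<le> i \<Longrightarrow> i < 2 * l \<Longrightarrow> j < d \<Longrightarrow> B $$ (i, j) = 0"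
    and mass: "\<And>c N. N\<in>carrier_mat d c \<Longrightarrow> frob_sq (B * N) \<le> (\<Sum>j\<le>i. frob_sq (C j * N)) \<and>
          (\<Sum>j\<le>i. frob_sq (C j * N)) \<le> frob_sq (B * N) + \<Delta> * frob_sq N"
    and tr: "frob_sq B + real l * \<Delta> \<le> (\<Sum>j\<le>i. frob_sq (C j))"
    by blast
  define B1 where "B1 = mat_block l d B 0 0 @\<^sub>r C (Suc i)"
  have top: "mat_block l d B 0 0 \<in> carrier_mat l d" by (auto simp: mat_block_def)
  have B1: "B1 \<in> carrier_mat (2 * l) d"
    using carrier_append_rows[OF top C[of "Suc i"]] by (simp add: B1_def mult_2)
  have m1: "frob_sq (B1 * N) = frob_sq (B * N) + frob_sq (C (Suc i) * N)" if "N \<in> carrier_mat d c" for N c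
    unfolding B1_def using frob_sq_append_rows_mult[OF top C that] frob_sq_top_block_mult[OF B z that] by simp
  have tr1: "frob_sq B1 = frob_sq B + frob_sq (C (Suc i))"
    using m1[of "1\<^sub>m d" d] B1 B C[of "Suc i"] by (simp add: right_mult_one_mat')
  from fd_shrink_bounds[OF step.hyps(2)[folded B1_def] B1] obtain \<eta> where e: "0 \<le> \<eta>" and B': "B' \<in> carrier_mat (2 * l) d"
    and z': "\<forall>i j. l \<le> i \<longrightarrow> i < 2 * l \<longrightarrow> j < d \<longrightarrow> B' $$ (i, j) = 0"
    and mass': "\<And>c N. N\<in>carrier_mat d c \<Longrightarrow> frob_sq (B' * N) \<le> frob_sq (B1 * N) \<and>
          frob_sq (B1 * N) \<le> frob_sq (B' * N) + \<eta> * frob_sq N"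
    and tr': "frob_sq B' + real l * \<eta> \<le> frob_sq B1"
    by blast
  have "frob_sq (B' * N) \<le> (\<Sum>j\<le>Suc i. frob_sq (C j * N)) \<and>
          (\<Sum>j\<le>Suc i. frob_sq (C j * N)) \<le> frob_sq (B' * N) + (\<Delta> + \<eta>) * frob_sq N"
    if N: "N \<in> carrier_mat d c" for N c
    using mass[OF N] mass'[OF N] m1[OF N] by (simp add: distrib_right)
  moreover have "frob_sq B' + real l * (\<Delta> + \<eta>) \<le> (\<Sum>j\<le>Suc i. frob_sq (C j))"
    using tr tr' tr1 by (simp add: distrib_left)
  ultimately show ?case
    using D e B' z' by (intro exI[of _ "\<Delta> + \<eta>"]) auto
qed

section \<open>The error of the best approximation in the row space of a sketch\<close>

lemma col_space_subset_imp_factor: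
  fixes V N :: "real mat"
  assumes V: "V \<in> carrier_mat d r" and N: "N \<in> carrier_mat d s"
    and sub: "vec_space.col_space d V \<subseteq> vec_space.col_space d N"
  shows "\<exists>K\<in>carrier_mat s r. V = N * K"
proof -
  interpret vec_space "TYPE(real)" d .
  have "\<forall>j<r. \<exists>x\<in>carrier_vec s. N *\<^sub>v x = col V j"
  proof (intro allI impI)
    fix j assume j: "j < r"
    have "set (cols V) \<subseteq> carrier_vec d" using V cols_dim by blast
    then have "col V j \<in> col_space V"
      using V j unfolding col_space_def by (intro span_mem) (auto simp: cols_def)
    then have "col V j \<in> col_space N" using sub by auto
    then show "\<exists>x\<in>carrier_vec s. N *\<^sub>v x = col V j"
      using col_space_eq[OF N] N by auto
  qed
  then obtain f where f: "\<And>j. j < r \<Longrightarrow> f j \<in> carrier_vec s \<and> N *\<^sub>v f j = col V j"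
    by metis
  define K where "K = mat s r (\<lambda>(i, j). f j $ i)"
  have K: "K \<in> carrier_mat s r"
    by (simp add: K_def)
  have colK: "col K j = f j" if "j < r" for j
    using f[OF that] that by (intro eq_vecI) (auto simp: K_def)
  have "V = N * K"
  proof (rule mat_col_eqI)
    fix j assume "j < dim_col (N * K)"
    then have j: "j < r" using K by simp
    show "col V j = col (N * K) j"
      using col_mult2[OF N K j] f[OF j] colK[OF j] by simp
  qed (use V N K in auto)
  then show ?thesis using K by blast
qed

text \<open>The columns of \<open>V\<close> and the rows of \<open>B\<close> span the same space, so \<open>B = N\<^sup>T V\<^sup>T\<close> and \<open>V\<^sup>T = K\<^sup>T B\<close>. The matrices
  \<open>X B\<close> and the matrices \<open>Z V\<^sup>T\<close>, with \<open>X\<close> and \<open>Z\<close> of rank at most \<open>k\<close>, are then the same, and among the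
  second kind the Pythagorean theorem singles out those with \<open>Z\<close> a best approximation of \<open>A V\<close>.\<close>

lemma projected_error_eq_row_space_error:
  assumes A: "A \<in> carrier_mat n d" and B: "B \<in> carrier_mat l d"
    and V: "V \<in> carrier_mat d r" "V\<^sup>T * V = 1\<^sub>m r"
    and span: "vec_space.col_space d V = vec_space.row_space d B"
    and Y: "best_rank_approx k (A * V) Y" and R: "best_rank_approx_in_rows B k A R"
  shows "frob_sq (A - Y * V\<^sup>T) = frob_sq (A - R)"
proof -
  note [simp] = carrier_matD[OF A] carrier_matD[OF B] carrier_matD[OF V(1)]
  interpret vec_space "TYPE(real)" d .
  have span': "vec_space.col_space d V = vec_space.col_space d B\<^sup>T"
    using span row_space_eq_col_space_transpose by simp
  obtain K where K: "K \<in> carrier_mat l r" "V = B\<^sup>T * K"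
    using col_space_subset_imp_factor[of V d r "B\<^sup>T" l] span' V B by auto
  obtain N where N: "N \<in> carrier_mat r l" "B\<^sup>T = V * N"
    using col_space_subset_imp_factor[of "B\<^sup>T" d l V r] span' V B by auto
  note [simp] = carrier_matD[OF K(1)] carrier_matD[OF N(1)]
  have BN: "B = N\<^sup>T * V\<^sup>T"
    using arg_cong[OF N(2), of transpose_mat] by (simp add: transpose_mult_dims)
  have VK: "V\<^sup>T = K\<^sup>T * B"
    using arg_cong[OF K(2), of transpose_mat] by (simp add: transpose_mult_dims)
  have Yc: "Y \<in> carrier_mat n r" "mat_rank Y \<le> k"
    and Ymin: "\<And>Z. Z \<in> carrier_mat n r \<Longrightarrow> mat_rank Z \<le> k \<Longrightarrow> frob_sq (A * V - Y) \<le> frob_sq (A * V - Z)"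
    using Y by (auto simp: best_rank_approx_def frob_norm_le_iff)
  obtain X where X: "X \<in> carrier_mat n l" "mat_rank X \<le> k" "R = X * B"
    and Xmin: "\<And>Z. Z \<in> carrier_mat n l \<Longrightarrow> mat_rank Z \<le> k \<Longrightarrow> frob_sq (A - X * B) \<le> frob_sq (A - Z * B)"
    using R by (auto simp: best_rank_approx_in_rows_def frob_norm_le_iff)
  have rank: "mat_rank (Z * W) \<le> k" if Z: "Z \<in> carrier_mat n a" "mat_rank Z \<le> k" and W: "W \<in> carrier_mat a b" for Z W a b
  proof -
    obtain c Z1 Z2 where f: "c \<le> k" "Z1 \<in> carrier_mat n c" "Z2 \<in> carrier_mat c a" "Z = Z1 * Z2"
      using rank_le_imp_factorization[OF Z] by blast
    have "Z * W = Z1 * (Z2 * W)" using f(2,3) W by (simp add: f(4))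
    then show ?thesis
      using rank_mult_le_inner_dim[OF f(2), of "Z2 * W" b] f W by simp
  qed
  note [simp] = carrier_matD[OF Yc(1)] carrier_matD[OF X(1)]
  have pyth: "frob_sq (A - Z * V\<^sup>T) = frob_sq A - frob_sq (A * V) + frob_sq (A * V - Z)"
    if "Z \<in> carrier_mat n r" for Z
    using that V(2) by (intro Pythagoras_orthonormal_columns) auto
  have XN: "X * N\<^sup>T \<in> carrier_mat n r" by (rule carrier_matI) auto
  have XB: "X * B = X * N\<^sup>T * V\<^sup>T"
    unfolding BN using V N by (simp add: mult_assoc_dims)
  have "frob_sq (A - Y * V\<^sup>T) \<le> frob_sq (A - X * B)"
    unfolding XB pyth[OF Yc(1)] pyth[OF XN]
    using Ymin[OF XN rank[OF X(1,2)]] N by simp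
  moreover have "Y * V\<^sup>T = Y * K\<^sup>T * B"
    unfolding VK by (simp add: mult_assoc_dims)
  then have "frob_sq (A - X * B) \<le> frob_sq (A - Y * V\<^sup>T)"
    using Xmin[of "Y * K\<^sup>T"] rank[OF Yc, of "K\<^sup>T" l] Yc K by simp
  ultimately show ?thesis using X by simp
qed

text \<open>The candidate is \<open>A U\<close>, where \<open>U\<close> projects onto the range of \<open>Q W\<close>, with \<open>W\<close> and \<open>Q\<close> the projections onto
  the row spaces of \<open>Ak\<close> and \<open>B\<close>. It captures at least as much of \<open>B\<close> as \<open>W\<close> does, since
  \<open>B W = B Q W = B U Q W = B U W\<close>. The hypotheses transfer this from \<open>B\<close> to \<open>M\<close>, and the Gram error transfers it
  from \<open>M\<close> to \<open>A\<close>.\<close>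

lemma sketch_row_space_error:
  assumes A: "A \<in> carrier_mat n d" and Ak: "Ak \<in> carrier_mat n d" "mat_rank Ak \<le> k"
    and B: "B \<in> carrier_mat l d" and M: "M \<in> carrier_mat m d" and \<Delta>: "0 \<le> \<Delta>"
    and mass: "\<And>N. N \<in> carrier_mat d d \<Longrightarrow> frob_sq (B * N) \<le> frob_sq (M * N)"
      "\<And>N. N \<in> carrier_mat d d \<Longrightarrow> frob_sq (M * N) \<le> frob_sq (B * N) + \<Delta> * frob_sq N"
  shows "\<exists>X\<in>carrier_mat n l. mat_rank X \<le> k \<and>
    frob_sq (A - X * B) \<le> frob_sq (A - Ak) + real k * \<Delta> + sqrt (2 * real k) * frob_norm (M\<^sup>T * M - A\<^sup>T * A)"
proof -
  note [simp] = carrier_matD[OF A] carrier_matD[OF B] carrier_matD[OF M] carrier_matD[OF Ak(1)]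
  obtain r Y Z where r: "r \<le> k" and YZ: "Y \<in> carrier_mat n r" "Z \<in> carrier_mat r d" "Ak = Y * Z"
    using rank_le_imp_factorization[OF Ak] by blast
  note [simp] = carrier_matD[OF YZ(1)] carrier_matD[OF YZ(2)]
  obtain W KW where W: "W \<in> carrier_mat d d" "KW \<in> carrier_mat r d" "W\<^sup>T = W" "W * W = W" "W * Z\<^sup>T = Z\<^sup>T" "W = Z\<^sup>T * KW" "frob_sq W \<le> real r"
    using orthogonal_projection_exists[of "Z\<^sup>T" d r] transpose_carrier_mat[THEN iffD2, OF YZ(2)] by blast
  obtain Q KQ where Q: "Q \<in> carrier_mat d d" "KQ \<in> carrier_mat l d" "Q\<^sup>T = Q" "Q * Q = Q" "Q * B\<^sup>T = B\<^sup>T" "Q = B\<^sup>T * KQ"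
    using orthogonal_projection_exists[of "B\<^sup>T" d l] transpose_carrier_mat[THEN iffD2, OF B] by blast
  note [simp] = carrier_matD[OF W(1)] carrier_matD[OF W(2)] carrier_matD[OF Q(1)] carrier_matD[OF Q(2)]
  define T where "T = Q * Z\<^sup>T"
  have T: "T \<in> carrier_mat d r" by (auto simp: T_def intro: carrier_matI)
  note [simp] = carrier_matD[OF T]
  obtain U KU where U: "U \<in> carrier_mat d d" "KU \<in> carrier_mat r d" "U\<^sup>T = U" "U * U = U" "U * T = T" "U = T * KU" "frob_sq U \<le> real r"
    using orthogonal_projection_exists[OF T] by blast
  note [simp] = carrier_matD[OF U(1)] carrier_matD[OF U(2)]
  \<comment> \<open>The coefficient matrix of \<open>A U\<close> with respect to the rows of \<open>B\<close>; it factors through \<open>r\<close> dimensions.\<close>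
  define X where "X = (A * KU\<^sup>T) * (Z * KQ\<^sup>T)"
  have X: "X \<in> carrier_mat n l" by (auto simp: X_def intro: carrier_matI)
  have "mat_rank X \<le> r"
    unfolding X_def by (rule rank_mult_le_inner_dim[of _ n r _ l]) (auto intro: carrier_matI)
  then have rankX: "mat_rank X \<le> k" using r by simp
  have "U\<^sup>T = KU\<^sup>T * T\<^sup>T" 
    using arg_cong[OF U(6), of transpose_mat] by (simp add: transpose_mult_dims)
  moreover have "T\<^sup>T = Z * Q" using Q(3) by (simp add: T_def transpose_mult_dims)
  moreover have "Q = KQ\<^sup>T * B"
    using arg_cong[OF Q(6), of transpose_mat] Q(3) by (simp add: transpose_mult_dims)
  ultimately have "U = KU\<^sup>T * (Z * (KQ\<^sup>T * B))" using U(3) by simp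
  then have XB: "X * B = A * U"
    by (simp add: X_def mult_assoc_dims)
  have QU: "Q * U = U"
  proof -
    have "Q * T = T" unfolding T_def using Q(4) by (subst mult_assoc_dims[symmetric]) auto
    then have "Q * (T * KU) = T * KU" by (subst mult_assoc_dims[symmetric]) auto
    then show ?thesis using U(6) by simp
  qed
  have UQ: "U * Q = U"
    using arg_cong[OF QU, of transpose_mat] U(3) Q(3) by (simp add: transpose_mult_dims)
  have BQ: "B * Q = B"
    using arg_cong[OF Q(5), of transpose_mat] Q(3) by (simp add: transpose_mult_dims)
  have "B * W = B * (U * W)"
  proof -
    have "U * (Q * W) = Q * W"
    proof -
      have QW: "Q * W = T * KW" unfolding T_def using arg_cong[OF W(6), of "\<lambda>X. Q * X"] by (simp add: mult_assoc_dims)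
      have "U * (T * KW) = U * T * KW" by (simp add: mult_assoc_dims)
      then show ?thesis unfolding QW U(5) by simp
    qed
    moreover have "U * (Q * W) = U * Q * W" by (simp add: mult_assoc_dims)
    ultimately have "U * W = Q * W" using UQ by simp
    moreover have "B * (Q * W) = B * Q * W" by (simp add: mult_assoc_dims)
    ultimately show ?thesis using BQ by simp
  qed
  then have "B * W = (B * U) * W" by (simp add: mult_assoc_dims)
  then have "frob_sq (B * W) \<le> frob_sq (B * U)"
    using frob_sq_mult_projection_le[of W "B * U"] W by simp
  then have captured: "frob_sq (M * W) - frob_sq (M * U) \<le> real r * \<Delta>"
    using mass(1)[OF U(1)] mass(2)[OF W(1)] mult_right_mono[OF W(7) \<Delta>] by (simp add: mult.commute)
  define E where "E = M\<^sup>T * M - A\<^sup>T * A"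
  have E[simp]: "dim_row E = d" "dim_col E = d" by (auto simp: E_def)
  have gram: "frob_sq (N * R) = frob_inner (N\<^sup>T * N) R"
    if "R \<in> carrier_mat d d" "R\<^sup>T = R" "R * R = R" "dim_col N = d" for N R
  proof -
    note [simp] = carrier_matD[OF that(1)]
    have "frob_sq (N * R) = frob_inner N (N * R * R\<^sup>T)"
      using that(4) by (subst frob_inner_mult_right) auto
    also have "N * R * R\<^sup>T = N * R"
      using that(2-4) by (simp add: mult_assoc_dims)
    also have "frob_inner N (N * R) = frob_inner (N * R) N"
      using that(4) by (intro frob_inner_commute) auto
    also have "\<dots> = frob_inner R (N\<^sup>T * N)"
      using that(4) by (intro frob_inner_mult_left) auto
    also have "\<dots> = frob_inner (N\<^sup>T * N) R"
      using that(4) by (intro frob_inner_commute) auto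
    finally show ?thesis .
  qed
  have "frob_inner E (W - U) = (frob_sq (M * W) - frob_sq (M * U)) - (frob_sq (A * W) - frob_sq (A * U))"
    using W U by (simp add: gram E_def frob_inner_diff_left frob_inner_diff_right)
  then have diff: "frob_sq (A * W) - frob_sq (A * U) \<le> real r * \<Delta> + \<bar>frob_inner E (W - U)\<bar>"
    using captured by simp
  \<comment> \<open>\<open>|W - U|\<^sup>2\<close> is at most the sum of the two ranks, because projections have nonnegative inner product.\<close>
  have "frob_inner W U = frob_sq (U * W)"
  proof -
    have "frob_sq (U * W) = frob_inner (U\<^sup>T * U) W" using gram[of W U] W by simp
    also have "\<dots> = frob_inner W U" using U by (simp add: frob_inner_commute)
    finally show ?thesis by simp
  qed
  then have "frob_sq (W - U) \<le> real r + real r"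
    using W(7) U(7) frob_sq_nonneg[of "U * W"] by (simp add: frob_sq_diff)
  also have "\<dots> \<le> 2 * real k" using r by simp
  finally have "frob_norm (W - U) \<le> sqrt (2 * real k)"
    unfolding frob_norm_sq[symmetric] by (rule real_le_rsqrt)
  then have "\<bar>frob_inner E (W - U)\<bar> \<le> sqrt (2 * real k) * frob_norm E"
    using frob_Cauchy_Schwarz[of E "W - U"] mult_right_mono[of "frob_norm (W - U)" "sqrt (2 * real k)" "frob_norm E"]
    by (simp add: mult.commute frob_norm_def[of E] sum_nonneg)
  moreover have "real r * \<Delta> \<le> real k * \<Delta>" using r \<Delta> by (intro mult_right_mono) auto
  ultimately have lost: "frob_sq (A * W) - frob_sq (A * U) \<le> real k * \<Delta> + sqrt (2 * real k) * frob_norm E"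
    using diff by simp
  have "Z * W = Z"
    using arg_cong[OF W(5), of transpose_mat] W(3) by (simp add: transpose_mult_dims)
  then have "Ak * W = Ak" by (simp add: YZ(3) mult_assoc_dims)
  then have "frob_sq (A - Ak) = frob_sq A - frob_sq (A * W) + frob_sq (A * W - Ak)"
    using W by (intro Pythagoras_projection) auto
  then have opt: "frob_sq A - frob_sq (A * W) \<le> frob_sq (A - Ak)"
    using frob_sq_nonneg[of "A * W - Ak"] by simp
  have "frob_sq (A - A * U) = frob_sq A - frob_sq (A * U) + frob_sq (A * U - A * U)"
    using U by (intro Pythagoras_projection) (auto simp: mult_assoc_dims)
  also have "frob_sq (A * U - A * U) = 0" by (simp add: frob_sq_diff)
  finally have "frob_sq (A - X * B) \<le> frob_sq (A - Ak) + real k * \<Delta> + sqrt (2 * real k) * frob_norm E"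
    unfolding XB using opt lost by simp
  then show ?thesis
    using X rankX unfolding E_def by blast
qed

section \<open>Second moments of sign forms under random hashing\<close>

abbreviation expect :: "'a pmf \<Rightarrow> ('a \<Rightarrow> real) \<Rightarrow> real" where
  "expect p f \<equiv> measure_pmf.expectation p f"

lemma expect_add:
  assumes "finite (set_pmf p)"
  shows "expect p (\<lambda>x. f x + g x) = expect p f + expect p g"
  by (intro Bochner_Integration.integral_add integrable_measure_pmf_finite assms)

lemma expect_sum:
  assumes "finite (set_pmf p)"
  shows "expect p (\<lambda>x. \<Sum>i\<in>I. f i x) = (\<Sum>i\<in>I. expect p (f i))"
  by (intro Bochner_Integration.integral_sum integrable_measure_pmf_finite assms)

lemma expect_mono:
  assumes "finite (set_pmf p)" "\<And>x. x \<in> set_pmf p \<Longrightarrow> f x \<le> g x"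
  shows "expect p f \<le> expect p g"
  using assms by (intro integral_mono_AE integrable_measure_pmf_finite) (auto simp: AE_measure_pmf_iff)

lemma expect_pair:
  assumes p: "finite (set_pmf p)" and q: "finite (set_pmf q)"
  shows "expect (pair_pmf p q) f = expect p (\<lambda>x. expect q (\<lambda>y. f (x, y)))"
proof -
  have "expect (pair_pmf p q) f = (\<Sum>z\<in>set_pmf p \<times> set_pmf q. f z * pmf (pair_pmf p q) z)"
    using p q by (intro integral_measure_pmf_real) auto
  also have "\<dots> = (\<Sum>x\<in>set_pmf p. \<Sum>y\<in>set_pmf q. f (x, y) * (pmf p x * pmf q y))"
    by (simp add: sum.cartesian_product case_prod_unfold pmf_pair[symmetric])
  also have "\<dots> = (\<Sum>x\<in>set_pmf p. expect q (\<lambda>y. f (x, y)) * pmf p x)"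
    using q by (subst integral_measure_pmf_real[of "set_pmf q"]) (auto simp: sum_distrib_left sum_distrib_right mult_ac)
  also have "\<dots> = expect p (\<lambda>x. expect q (\<lambda>y. f (x, y)))"
    using p by (subst integral_measure_pmf_real[of "set_pmf p"]) auto
  finally show ?thesis .
qed

lemma finite_set_Pi_pmf:
  assumes "finite A" "\<And>i. i \<in> A \<Longrightarrow> finite (set_pmf (p i))"
  shows "finite (set_pmf (Pi_pmf A dflt p))"
  using assms by (simp add: set_Pi_pmf) (auto intro!: finite_PiE_dflt)

lemma expect_Pi_insert:
  assumes "finite A" "z \<notin> A" "\<And>i. i \<in> insert z A \<Longrightarrow> finite (set_pmf (p i))"
  shows "expect (Pi_pmf (insert z A) dflt p) f = expect (p z) (\<lambda>y. expect (Pi_pmf A dflt p) (\<lambda>g. f (g(z := y))))"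
  using assms by (simp add: Pi_pmf_insert expect_pair finite_set_Pi_pmf)

text \<open>Independence and centering make all cross terms vanish.\<close>

lemma second_moment_independent_sum:
  assumes "finite I" "\<And>i. i \<in> I \<Longrightarrow> finite (set_pmf (p i))" "\<And>i. i \<in> I \<Longrightarrow> expect (p i) (Z i) = 0"
  shows "expect (Pi_pmf I dflt p) (\<lambda>\<omega>. (\<Sum>i\<in>I. Z i (\<omega> i))\<^sup>2) = (\<Sum>i\<in>I. expect (p i) (\<lambda>y. (Z i y)\<^sup>2))"
  using assms
proof (induction I rule: finite_induct)
  case (insert z I)
  define S where "S g = (\<Sum>i\<in>I. Z i (g i))" for g
  let ?Q = "Pi_pmf I dflt p"
  have fin: "finite (set_pmf ?Q)" "finite (set_pmf (p z))"
    using insert.hyps(1) insert.prems(1) by (auto intro!: finite_set_Pi_pmf)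
  have upd: "(\<Sum>i\<in>insert z I. Z i ((g(z := y)) i)) = Z z y + S g" for g y
    using insert.hyps by (simp add: S_def) (intro sum.cong, auto)
  have "expect ?Q (\<lambda>g. (Z z y + S g)\<^sup>2) = (Z z y)\<^sup>2 + (Z z y * (2 * expect ?Q S) + expect ?Q (\<lambda>g. (S g)\<^sup>2))" for y
  proof -
    have "expect ?Q (\<lambda>g. (Z z y + S g)\<^sup>2) = expect ?Q (\<lambda>g. (Z z y)\<^sup>2 + (2 * Z z y * S g + (S g)\<^sup>2))"
      by (simp add: power2_sum algebra_simps)
    then show ?thesis using fin by (simp add: expect_add)
  qed
  then have "expect (p z) (\<lambda>y. expect ?Q (\<lambda>g. (Z z y + S g)\<^sup>2)) =
      expect (p z) (\<lambda>y. (Z z y)\<^sup>2) + expect ?Q (\<lambda>g. (S g)\<^sup>2)"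
    using fin insert.prems(2)[of z] by (simp add: expect_add)
  moreover have "expect ?Q (\<lambda>g. (S g)\<^sup>2) = (\<Sum>i\<in>I. expect (p i) (\<lambda>y. (Z i y)\<^sup>2))"
    unfolding S_def using insert by auto
  ultimately show ?case
    using insert.hyps by (simp only: expect_Pi_insert[OF insert.hyps insert.prems(1)] upd) simp
qed simp

abbreviation sign_pmf :: "real pmf" where
  "sign_pmf \<equiv> pmf_of_set {-1, 1}"

lemma expect_sign: "expect sign_pmf f = (f 1 + f (-1)) / 2"
  by (subst integral_pmf_of_set) auto

lemma finite_set_sign_pmf: "finite (set_pmf sign_pmf)"
  by simp

text \<open>Induction on the number of signs. Revealing the sign at \<open>z\<close> turns the form \<open>Z\<close> over the other
  indices into \<open>Z + L\<close> or \<open>Z - L\<close>, with \<open>L\<close> linear in their signs, and averaging over the two cases leaves the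
  second moments of \<open>Z\<close> and \<open>L\<close>. The factor 2 comes from \<open>(u z y + u y z)\<^sup>2 \<le> 2 (u z y)\<^sup>2 + 2 (u y z)\<^sup>2\<close>, as \<open>u\<close>
  may fail to be symmetric.\<close>

lemma Rademacher_chaos_moments:
  fixes u :: "'a \<Rightarrow> 'a \<Rightarrow> real"
  assumes "finite A" "\<And>x. u x x = 0"
  defines "Q A' \<equiv> Pi_pmf A' 1 (\<lambda>_::'a. sign_pmf)"
  shows "expect (Q A) (\<lambda>s. \<Sum>x\<in>A. \<Sum>y\<in>A. s x * s y * u x y) = 0"
    and "expect (Q A) (\<lambda>s. (\<Sum>x\<in>A. \<Sum>y\<in>A. s x * s y * u x y)\<^sup>2) \<le> 2 * (\<Sum>x\<in>A. \<Sum>y\<in>A. (u x y)\<^sup>2)"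
  using assms(1)
proof (induction A rule: finite_induct)
  case empty
  { case 1 show ?case by simp next case 2 show ?case by simp }
next
  case (insert z A)
  define Z where "Z s = (\<Sum>x\<in>A. \<Sum>y\<in>A. s x * s y * u x y)" for s
  define L where "L s = (\<Sum>y\<in>A. s y * (u z y + u y z))" for s
  have fin: "finite (set_pmf (Q A'))" if "finite A'" for A'
    unfolding Q_def using that by (intro finite_set_Pi_pmf) auto
  \<comment> \<open>The term \<open>r\<^sup>2 u z z\<close> vanishes, so the form is affine in the new sign \<open>r\<close>.\<close>
  have upd: "(\<Sum>x\<in>insert z A. \<Sum>y\<in>insert z A. (s(z := r)) x * (s(z := r)) y * u x y) = Z s + r * L s" for s r
  proof -
    have neq: "x \<noteq> z" if "x \<in> A" for x using that insert.hyps by auto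
    have "(\<Sum>x\<in>insert z A. \<Sum>y\<in>insert z A. (s(z := r)) x * (s(z := r)) y * u x y)
       = (\<Sum>y\<in>A. r * s y * u z y) + (\<Sum>x\<in>A. s x * r * u x z + (\<Sum>y\<in>A. s x * s y * u x y))"
      by (simp add: insert.hyps neq assms(2) cong: sum.cong)
    then show ?thesis
      by (simp add: Z_def L_def sum.distrib sum_distrib_left algebra_simps)
  qed
  have step: "expect (Q (insert z A)) (\<lambda>s. G (\<Sum>x\<in>insert z A. \<Sum>y\<in>insert z A. s x * s y * u x y)) =
      (expect (Q A) (\<lambda>s. G (Z s + L s)) + expect (Q A) (\<lambda>s. G (Z s - L s))) / 2" for G
  proof -
    have ins: "expect (Q (insert z A)) F = expect sign_pmf (\<lambda>r. expect (Q A) (\<lambda>s. F (s(z := r))))" for F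
      unfolding Q_def by (intro expect_Pi_insert insert.hyps) simp
    show ?thesis
      unfolding ins upd expect_sign by simp
  qed
  have sign: "expect sign_pmf (\<lambda>r. r * c) = 0" "expect sign_pmf (\<lambda>r. (r * c)\<^sup>2) = c\<^sup>2" for c
    by (simp_all add: expect_sign)
  have EL: "expect (Q A) (\<lambda>s. (L s)\<^sup>2) = (\<Sum>y\<in>A. (u z y + u y z)\<^sup>2)"
    unfolding L_def Q_def
      second_moment_independent_sum[of A "\<lambda>_. sign_pmf" "\<lambda>y r. r * (u z y + u y z)",
        OF insert.hyps(1) finite_set_sign_pmf sign(1)]
      sign(2) ..
  {
    case 1
    note step[of "\<lambda>x. x"]
    also have "(expect (Q A) (\<lambda>s. Z s + L s) + expect (Q A) (\<lambda>s. Z s - L s)) / 2 = expect (Q A) Z"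
      using fin[OF insert.hyps(1)] expect_add[of "Q A" "\<lambda>s. Z s + L s" "\<lambda>s. Z s - L s"] by simp
    also have "\<dots> = 0"
      using insert.IH(1) unfolding Z_def[abs_def] .
    finally show ?case .
  next
    case 2
    have "expect (Q A) (\<lambda>s. (Z s + L s)\<^sup>2) + expect (Q A) (\<lambda>s. (Z s - L s)\<^sup>2) =
       expect (Q A) (\<lambda>s. (Z s + L s)\<^sup>2 + (Z s - L s)\<^sup>2)"
      by (rule expect_add[symmetric]) (rule fin[OF insert.hyps(1)])
    also have "\<dots> = expect (Q A) (\<lambda>s. 2 * (Z s)\<^sup>2 + 2 * (L s)\<^sup>2)"
      by (simp add: power2_eq_square algebra_simps)
    also have "\<dots> = 2 * expect (Q A) (\<lambda>s. (Z s)\<^sup>2) + 2 * expect (Q A) (\<lambda>s. (L s)\<^sup>2)"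
      using fin[OF insert.hyps(1)] by (simp add: expect_add)
    finally have sq: "(expect (Q A) (\<lambda>s. (Z s + L s)\<^sup>2) + expect (Q A) (\<lambda>s. (Z s - L s)\<^sup>2)) / 2 =
       expect (Q A) (\<lambda>s. (Z s)\<^sup>2) + (\<Sum>y\<in>A. (u z y + u y z)\<^sup>2)"
      using EL by simp
    note step[of "\<lambda>x. x\<^sup>2"]
    also note sq
    also have "\<dots> \<le> 2 * (\<Sum>x\<in>A. \<Sum>y\<in>A. (u x y)\<^sup>2) + (\<Sum>y\<in>A. 2 * (u z y)\<^sup>2 + 2 * (u y z)\<^sup>2)"
    proof (intro add_mono sum_mono)
      show "expect (Q A) (\<lambda>s. (Z s)\<^sup>2) \<le> 2 * (\<Sum>x\<in>A. \<Sum>y\<in>A. (u x y)\<^sup>2)"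
        using insert.IH(2) by (simp add: Z_def)
      show "(u z y + u y z)\<^sup>2 \<le> 2 * (u z y)\<^sup>2 + 2 * (u y z)\<^sup>2" for y
        using sum_squares_bound[of "u z y" "u y z"] unfolding power2_sum by linarith
    qed
    also have "\<dots> = 2 * (\<Sum>x\<in>insert z A. \<Sum>y\<in>insert z A. (u x y)\<^sup>2)"
      using insert.hyps assms(2) by (simp add: sum.distrib sum_distrib_left)
    finally show ?case .
  }
qed

text \<open>Given all hash values except the one of \<open>x\<close>, that one hits \<open>h y\<close> with probability at most \<open>1 / l\<close>.\<close>

lemma hash_collision_le:
  assumes "finite A" "x \<in> A" "y \<in> A" "x \<noteq> y" "0 < l"
  shows "expect (Pi_pmf A 0 (\<lambda>_. pmf_of_set {..<l})) (\<lambda>h. of_bool (h x = h y)) \<le> 1 / real l"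
proof -
  have ne: "{..<l} \<noteq> {}" "finite {..<l}" using \<open>0 < l\<close> by auto
  have finU: "finite (set_pmf (pmf_of_set {..<l}))" using \<open>0 < l\<close> by (subst set_pmf_of_set) auto
  let ?U = "pmf_of_set {..<l}"
  let ?A = "A - {x}"
  have fin: "finite (set_pmf ?U)" "finite (set_pmf (Pi_pmf ?A 0 (\<lambda>_. ?U)))"
    using finU assms(1) by (auto intro!: finite_set_Pi_pmf)
  have swap: "expect (pair_pmf ?U (Pi_pmf ?A 0 (\<lambda>_. ?U))) F =
    expect (Pi_pmf ?A 0 (\<lambda>_. ?U)) (\<lambda>h. expect ?U (\<lambda>v. F (v, h)))" for F
    using fin by (subst pair_commute_pmf) (simp add: expect_pair)
  have "expect (Pi_pmf (insert x ?A) 0 (\<lambda>_. ?U)) (\<lambda>h. of_bool (h x = h y)) =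
     expect (Pi_pmf ?A 0 (\<lambda>_. ?U)) (\<lambda>h. expect ?U (\<lambda>v. of_bool (v = h y)))"
    using assms by (subst Pi_pmf_insert) (auto simp: swap)
  also have "\<dots> \<le> expect (Pi_pmf ?A 0 (\<lambda>_. ?U)) (\<lambda>h. 1 / real l)"
  proof (intro expect_mono fin)
    fix h :: "'a \<Rightarrow> nat"
    have "expect ?U (\<lambda>v. of_bool (v = h y)) = (\<Sum>v<l. of_bool (v = h y)) / real l"
      using ne by (subst integral_pmf_of_set) auto
    also have "(\<Sum>v<l. of_bool (v = h y)) \<le> (1 :: real)"
      by (simp add: of_bool_def sum.delta)
    finally show "expect ?U (\<lambda>v. of_bool (v = h y)) \<le> 1 / real l"
      by (simp add: divide_right_mono)
  qed
  finally show ?thesis using assms by (simp add: insert_absorb)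
qed

definition block_seed_pmf :: "nat \<Rightarrow> nat \<Rightarrow> ((nat \<Rightarrow> nat) \<times> (nat \<Rightarrow> real)) pmf" where
  "block_seed_pmf l m = pair_pmf (Pi_pmf {..<m} 0 (\<lambda>_. pmf_of_set {..<l})) (Pi_pmf {..<m} 1 (\<lambda>_. sign_pmf))"

text \<open>The off-diagonal part of a Gram entry of one sketched block: \<open>x\<close> and \<open>y\<close> run over the columns of the SpEmb
  matrix, and a pair contributes when both are hashed to the same row.\<close>

definition sketch_chaos :: "nat \<Rightarrow> (nat \<Rightarrow> nat \<Rightarrow> real) \<Rightarrow> (nat \<Rightarrow> nat) \<times> (nat \<Rightarrow> real) \<Rightarrow> real" where
  "sketch_chaos m w = (\<lambda>(h, s). \<Sum>x<m. \<Sum>y<m. if x \<noteq> y \<and> h x = h y then s x * s y * w x y else 0)"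

lemma finite_block_seeds:
  assumes "0 < l" shows "finite (set_pmf (block_seed_pmf l m))"
proof -
  have ne: "{..<l} \<noteq> {}" "finite {..<l}" using \<open>0 < l\<close> by auto
  then show ?thesis
    unfolding block_seed_pmf_def set_pair_pmf
    by (intro finite_cartesian_product finite_set_Pi_pmf) auto
qed

lemma sketch_chaos_moments:
  assumes l: "0 < l"
  shows "expect (block_seed_pmf l m) (sketch_chaos m w) = 0"
    and "expect (block_seed_pmf l m) (\<lambda>\<omega>. (sketch_chaos m w \<omega>)\<^sup>2)
      \<le> 2 / real l * (\<Sum>x<m. \<Sum>y<m. if x = y then 0 else (w x y)\<^sup>2)"
proof -
  have finU: "finite (set_pmf (pmf_of_set {..<l}))" using \<open>0 < l\<close> by (subst set_pmf_of_set) auto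
  let ?H = "Pi_pmf {..<m} 0 (\<lambda>_. pmf_of_set {..<l})"
  let ?S = "Pi_pmf {..<m} 1 (\<lambda>_. sign_pmf)"
  have fin: "finite (set_pmf ?H)" "finite (set_pmf ?S)"
    using finU by (auto intro!: finite_set_Pi_pmf)
  define u where "u h x y = (if x \<noteq> y \<and> h x = h y then w x y else 0)" for h :: "nat \<Rightarrow> nat" and x y
  have Z: "sketch_chaos m w (h, s) = (\<Sum>x<m. \<Sum>y<m. s x * s y * u h x y)" for h s
    by (auto simp: sketch_chaos_def u_def intro!: sum.cong)
  have u0: "u h x x = 0" for h x by (simp add: u_def)
  show "expect (block_seed_pmf l m) (sketch_chaos m w) = 0"
    unfolding block_seed_pmf_def
    by (simp add: expect_pair[OF fin] Z Rademacher_chaos_moments(1) u0)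
  have moment: "expect ?S (\<lambda>s. (\<Sum>x<m. \<Sum>y<m. s x * s y * u h x y)\<^sup>2) \<le> 2 * (\<Sum>x<m. \<Sum>y<m. (u h x y)\<^sup>2)" for h
    by (rule Rademacher_chaos_moments(2)) (simp_all add: u0)
  have "expect (block_seed_pmf l m) (\<lambda>\<omega>. (sketch_chaos m w \<omega>)\<^sup>2)
     \<le> expect ?H (\<lambda>h. \<Sum>x<m. \<Sum>y<m. 2 * (u h x y)\<^sup>2)"
    unfolding block_seed_pmf_def expect_pair[OF fin]
    using moment by (intro expect_mono fin) (simp add: Z sum_distrib_left)
  also have "\<dots> = (\<Sum>x<m. \<Sum>y<m. expect ?H (\<lambda>h. 2 * (u h x y)\<^sup>2))"
    by (simp only: expect_sum[OF fin(1)])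
  also have "\<dots> \<le> (\<Sum>x<m. \<Sum>y<m. 2 / real l * (if x = y then 0 else (w x y)\<^sup>2))"
  proof (intro sum_mono)
    fix x y assume xy: "x \<in> {..<m}" "y \<in> {..<m}"
    show "expect ?H (\<lambda>h. 2 * (u h x y)\<^sup>2) \<le> 2 / real l * (if x = y then 0 else (w x y)\<^sup>2)"
    proof (cases "x = y")
      case False
      have "expect ?H (\<lambda>h. 2 * (u h x y)\<^sup>2) = expect ?H (\<lambda>h. (2 * (w x y)\<^sup>2) * of_bool (h x = h y))"
        using False by (intro arg_cong[where f = "expect ?H"] ext) (auto simp: u_def)
      also have "\<dots> = (2 * (w x y)\<^sup>2) * expect ?H (\<lambda>h. of_bool (h x = h y))"
        by (simp only: integral_mult_right_zero)
      also have "\<dots> \<le> (2 * (w x y)\<^sup>2) * (1 / real l)"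
        using xy False l by (intro mult_left_mono hash_collision_le) auto
      finally show ?thesis using False by simp
    qed (simp add: u0)
  qed
  finally show "expect (block_seed_pmf l m) (\<lambda>\<omega>. (sketch_chaos m w \<omega>)\<^sup>2)
      \<le> 2 / real l * (\<Sum>x<m. \<Sum>y<m. if x = y then 0 else (w x y)\<^sup>2)"
    by (simp add: sum_distrib_left)
qed

lemma block_members:
  assumes "c < q"
  shows "(\<Sum>y<q * b. of_bool (y div b = c)) = real b"
proof -
  have "(\<Sum>y<q * b. of_bool (y div b = c)) = (\<Sum>i<q. \<Sum>a<b. of_bool (i = c) :: real)"
    unfolding sum_lessThan_mult by (intro sum.cong refl) auto
  also have "\<dots> = (\<Sum>i<q. if i = c then real b else 0)"
    by (intro sum.cong) auto
  also have "\<dots> = real b" using assms by simp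
  finally show ?thesis .
qed

text \<open>For fixed \<open>i\<close>, composing with a transposition shows that all \<open>j \<noteq> i\<close> have the same probability of sharing
  the block of \<open>i\<close>. Under every permutation exactly \<open>b - 1\<close> of these \<open>q b - 1\<close> indices do, and
  \<open>(b - 1) / (q b - 1) \<le> 1 / q\<close>.\<close>

lemma same_block_probability:
  fixes q b i j :: nat
  assumes q: "0 < q" and ij: "i < q * b" "j < q * b" "i \<noteq> j"
  shows "expect (pmf_of_set {p. p permutes {..<q * b}}) (\<lambda>p. of_bool (p j div b = p i div b)) \<le> 1 / real q"
proof -
  let ?n = "q * b"
  let ?S = "{p. p permutes {..<?n}}"
  let ?E = "expect (pmf_of_set ?S)"
  have S: "finite ?S" "?S \<noteq> {}"
    using finite_permutations[of "{..<?n}"] permutes_id by blast+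
  have fin: "finite (set_pmf (pmf_of_set ?S))" using S by simp
  have sym: "?E (\<lambda>p. of_bool (p j' div b = p i div b)) = ?E (\<lambda>p. of_bool (p j div b = p i div b))"
    if j': "j' < ?n" "j' \<noteq> i" for j'
  proof -
    define \<tau> where "\<tau> = Transposition.transpose j j'"
    have \<tau>: "\<tau> permutes {..<?n}" unfolding \<tau>_def using ij j' by (intro permutes_swap_id) auto
    have bij: "bij_betw (\<lambda>p. p \<circ> \<tau>) ?S ?S"
      by (rule bij_betw_byWitness[of _ "\<lambda>p. p \<circ> \<tau>"])
         (use \<tau> in \<open>auto simp: \<tau>_def comp_assoc intro: permutes_compose\<close>)
    have "(\<Sum>p\<in>?S. of_bool (p j div b = p i div b) :: real) = (\<Sum>p\<in>?S. of_bool ((p \<circ> \<tau>) j div b = (p \<circ> \<tau>) i div b))"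
      by (rule sum.reindex_bij_betw[OF bij, symmetric])
    also have "\<dots> = (\<Sum>p\<in>?S. of_bool (p j' div b = p i div b))"
      using ij j' by (simp add: \<tau>_def Transposition.transpose_def)
    finally show ?thesis using S by (simp add: integral_pmf_of_set)
  qed
  have count: "(\<Sum>j'\<in>{..<?n} - {i}. of_bool (p j' div b = p i div b)) = real b - 1" if p: "p permutes {..<?n}" for p
  proof -
    have "p i < ?n" using permutes_in_image[OF p, of i] ij by simp
    then have "p i div b < q" by (simp add: less_mult_imp_div_less)
    then have "real b = (\<Sum>y<?n. of_bool (y div b = p i div b))" by (rule block_members[symmetric])
    also have "\<dots> = (\<Sum>j'<?n. of_bool (p j' div b = p i div b))"
      by (rule sum.reindex_bij_betw[OF permutes_imp_bij[OF p], symmetric])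
    also have "\<dots> = 1 + (\<Sum>j'\<in>{..<?n} - {i}. of_bool (p j' div b = p i div b))"
      using ij by (subst sum.remove[of _ i]) auto
    finally show ?thesis by simp
  qed
  have "Suc (card ({..<?n} - {i})) = ?n" using card_Suc_Diff1[of "{..<?n}" i] ij by simp
  then have "real (Suc (card ({..<?n} - {i}))) = real ?n" by (simp only:)
  then have card: "real (card ({..<?n} - {i})) = real ?n - 1" by simp
  have "(\<Sum>j'\<in>{..<?n} - {i}. ?E (\<lambda>p. of_bool (p j' div b = p i div b))) =
      (\<Sum>j'\<in>{..<?n} - {i}. ?E (\<lambda>p. of_bool (p j div b = p i div b)))"
    by (intro sum.cong refl sym) auto
  then have "(real ?n - 1) * ?E (\<lambda>p. of_bool (p j div b = p i div b)) =
      (\<Sum>j'\<in>{..<?n} - {i}. ?E (\<lambda>p. of_bool (p j' div b = p i div b)))"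
    by (simp only: sum_constant card)
  also have "\<dots> = ?E (\<lambda>p. \<Sum>j'\<in>{..<?n} - {i}. of_bool (p j' div b = p i div b))"
    by (rule expect_sum[OF fin, symmetric])
  also have "\<dots> \<le> ?E (\<lambda>p. real b - 1)"
    by (intro expect_mono fin) (use S count in auto)
  finally have "(real ?n - 1) * ?E (\<lambda>p. of_bool (p j div b = p i div b)) \<le> real b - 1" by simp
  moreover have n1: "1 < real ?n" using ij by linarith
  ultimately have "?E (\<lambda>p. of_bool (p j div b = p i div b)) \<le> (real b - 1) / (real ?n - 1)"
    by (simp add: pos_le_divide_eq mult.commute)
  also have "\<dots> \<le> 1 / real q"
  proof -
    have "real q * (real b - 1) \<le> real ?n - 1"
      using q by (simp add: right_diff_distrib)
    then show ?thesis using n1 q by (simp add: field_simps)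
  qed
  finally show ?thesis .
qed

text \<open>Summing over the positions of a block is, after substituting \<open>p\<close>, summing over the pairs of rows that \<open>p\<close>
  sends to a common block.\<close>

lemma expected_within_block_sum:
  fixes f :: "nat \<Rightarrow> nat \<Rightarrow> real"
  assumes q: "0 < q" and f: "\<And>i j. 0 \<le> f i j"
  shows "expect (pmf_of_set {p. p permutes {..<q * b}})
      (\<lambda>p. \<Sum>c<q. \<Sum>x<b. \<Sum>y<b. if x = y then 0 else f (inv_into UNIV p (c * b + x)) (inv_into UNIV p (c * b + y)))
    \<le> (\<Sum>i<q * b. \<Sum>j<q * b. f i j) / real q"
proof -
  let ?n = "q * b"
  let ?S = "{p. p permutes {..<?n}}"
  let ?E = "expect (pmf_of_set ?S)"
  have S: "finite ?S" "?S \<noteq> {}"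
    using finite_permutations[of "{..<?n}"] permutes_id by blast+
  have fin: "finite (set_pmf (pmf_of_set ?S))" using S by simp
  have re: "(\<Sum>c<q. \<Sum>x<b. \<Sum>y<b. if x = y then 0 else f (inv_into UNIV p (c * b + x)) (inv_into UNIV p (c * b + y))) =
     (\<Sum>i<?n. \<Sum>j<?n. (if i = j then 0 else f i j) * of_bool (p j div b = p i div b))"
    if p: "p permutes {..<?n}" for p
  proof -
    have "(\<Sum>i<?n. \<Sum>j<?n. (if i = j then 0 else f i j) * of_bool (p j div b = p i div b)) =
       (\<Sum>i<?n. \<Sum>j<?n. (if p i = p j then 0 else f (inv_into UNIV p (p i)) (inv_into UNIV p (p j))) * of_bool (p j div b = p i div b))"
      using permutes_inj[OF p] by (intro sum.cong) (auto simp: inj_eq permutes_inverses[OF p])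
    also have "\<dots> = (\<Sum>i<?n. \<Sum>y<?n. (if p i = y then 0 else f (inv_into UNIV p (p i)) (inv_into UNIV p y)) * of_bool (y div b = p i div b))"
      by (intro sum.cong refl sum.reindex_bij_betw[OF permutes_imp_bij[OF p]])
    also have "\<dots> = (\<Sum>x<?n. \<Sum>y<?n. (if x = y then 0 else f (inv_into UNIV p x) (inv_into UNIV p y)) * of_bool (y div b = x div b))"
      by (rule sum.reindex_bij_betw[OF permutes_imp_bij[OF p]])
    also have "\<dots> = (\<Sum>c<q. \<Sum>x<b. \<Sum>c'<q. \<Sum>y<b. if c' = c then (if x = y then 0 else f (inv_into UNIV p (c * b + x)) (inv_into UNIV p (c * b + y))) else 0)"
      unfolding sum_lessThan_mult by (intro sum.cong refl) auto
    also have "\<dots> = (\<Sum>c<q. \<Sum>x<b. \<Sum>c'<q. if c' = c then (\<Sum>y<b. if x = y then 0 else f (inv_into UNIV p (c * b + x)) (inv_into UNIV p (c * b + y))) else 0)"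
      by (intro sum.cong refl) auto
    also have "\<dots> = (\<Sum>c<q. \<Sum>x<b. \<Sum>y<b. if x = y then 0 else f (inv_into UNIV p (c * b + x)) (inv_into UNIV p (c * b + y)))"
      by (rule sum.cong[OF refl], rule sum.cong[OF refl]) (simp add: sum.delta)
    finally show ?thesis by simp
  qed
  have "?E (\<lambda>p. \<Sum>c<q. \<Sum>x<b. \<Sum>y<b. if x = y then 0 else f (inv_into UNIV p (c * b + x)) (inv_into UNIV p (c * b + y)))
    \<le> ?E (\<lambda>p. \<Sum>i<?n. \<Sum>j<?n. (if i = j then 0 else f i j) * of_bool (p j div b = p i div b))"
    by (intro expect_mono fin) (use S re in auto)
  also have "\<dots> = (\<Sum>i<?n. \<Sum>j<?n. (if i = j then 0 else f i j) * ?E (\<lambda>p. of_bool (p j div b = p i div b)))"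
    by (simp only: expect_sum[OF fin] integral_mult_right_zero)
  also have "\<dots> \<le> (\<Sum>i<?n. \<Sum>j<?n. f i j * (1 / real q))"
  proof (intro sum_mono)
    fix i j assume "i \<in> {..<?n}" "j \<in> {..<?n}"
    then show "(if i = j then 0 else f i j) * ?E (\<lambda>p. of_bool (p j div b = p i div b)) \<le> f i j * (1 / real q)"
      using f[of i j] mult_left_mono[OF same_block_probability[OF q, of i b j] f[of i j]] by auto
  qed
  finally show ?thesis
    by (simp add: sum_divide_distrib)
qed

text \<open>The default seed has all signs zero, so that the
  matrix built from it is the zero matrix, the default value of \<open>block_spemb_pmf\<close>.\<close>

definition seed_pmf :: "nat \<Rightarrow> nat \<Rightarrow> nat \<Rightarrow> ((nat \<Rightarrow> (nat \<Rightarrow> nat) \<times> (nat \<Rightarrow> real)) \<times> (nat \<Rightarrow> nat)) pmf" where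
  "seed_pmf q l b = pair_pmf (Pi_pmf {..<q} (\<lambda>_. 0, \<lambda>_. 0) (\<lambda>_. block_seed_pmf l b)) (pmf_of_set {p. p permutes {..<q * b}})"

definition total_chaos where
  "total_chaos q b w = (\<lambda>(\<omega>, p). \<Sum>c<q. sketch_chaos b (\<lambda>x y. w (inv_into UNIV p (c * b + x)) (inv_into UNIV p (c * b + y))) (\<omega> c))"

lemma finite_seeds:
  assumes "0 < l" shows "finite (set_pmf (seed_pmf q l b))"
proof -
  have "finite {p. p permutes {..<q * b}}" "{p. p permutes {..<q * b}} \<noteq> {}"
    using finite_permutations[of "{..<q * b}"] permutes_id by blast+
  then show ?thesis
    using assms unfolding seed_pmf_def set_pair_pmf
    by (intro finite_cartesian_product finite_set_Pi_pmf finite_block_seeds) auto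
qed

text \<open>Given the permutation, the blocks are independent and centered, so their second moments add up to a sum
  over pairs of positions within blocks; averaging over the permutation gains the factor \<open>1 / q\<close>.\<close>

lemma total_chaos_second_moment:
  assumes l: "0 < l" and q: "0 < q"
  shows "expect (seed_pmf q l b) (\<lambda>z. (total_chaos q b w z)\<^sup>2) \<le> 2 / real (q * l) * (\<Sum>i<q * b. \<Sum>j<q * b. (w i j)\<^sup>2)"
proof -
  let ?D = "Pi_pmf {..<q} (\<lambda>_. 0, \<lambda>_. 0) (\<lambda>_. block_seed_pmf l b)"
  let ?R = "pmf_of_set {p. p permutes {..<q * b}}"
  have "finite {p. p permutes {..<q * b}}" "{p. p permutes {..<q * b}} \<noteq> {}"
    using finite_permutations[of "{..<q * b}"] permutes_id by blast+
  then have fin: "finite (set_pmf ?D)" "finite (set_pmf ?R)"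
    using l by (auto intro!: finite_set_Pi_pmf finite_block_seeds)
  have "expect (seed_pmf q l b) (\<lambda>z. (total_chaos q b w z)\<^sup>2) = expect ?R (\<lambda>p. expect ?D (\<lambda>\<omega>. (total_chaos q b w (\<omega>, p))\<^sup>2))"
    unfolding seed_pmf_def using fin by (subst pair_commute_pmf) (simp add: expect_pair)
  also have "\<dots> \<le> expect ?R (\<lambda>p. 2 / real l * (\<Sum>c<q. \<Sum>x<b. \<Sum>y<b. if x = y then 0 else (w (inv_into UNIV p (c * b + x)) (inv_into UNIV p (c * b + y)))\<^sup>2))"
  proof (intro expect_mono fin)
    fix p
    have "expect ?D (\<lambda>\<omega>. (total_chaos q b w (\<omega>, p))\<^sup>2) =
      (\<Sum>c<q. expect (block_seed_pmf l b) (\<lambda>\<omega>. (sketch_chaos b (\<lambda>x y. w (inv_into UNIV p (c * b + x)) (inv_into UNIV p (c * b + y))) \<omega>)\<^sup>2))"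
      unfolding total_chaos_def prod.case
      by (intro second_moment_independent_sum finite_block_seeds sketch_chaos_moments l) auto
    also have "\<dots> \<le> (\<Sum>c<q. 2 / real l * (\<Sum>x<b. \<Sum>y<b. if x = y then 0 else (w (inv_into UNIV p (c * b + x)) (inv_into UNIV p (c * b + y)))\<^sup>2))"
      by (intro sum_mono sketch_chaos_moments l)
    finally show "expect ?D (\<lambda>\<omega>. (total_chaos q b w (\<omega>, p))\<^sup>2) \<le> 2 / real l * (\<Sum>c<q. \<Sum>x<b. \<Sum>y<b. if x = y then 0 else (w (inv_into UNIV p (c * b + x)) (inv_into UNIV p (c * b + y)))\<^sup>2)"
      by (simp only: sum_distrib_left)
  qed
  also have "\<dots> = 2 / real l * expect ?R (\<lambda>p. \<Sum>c<q. \<Sum>x<b. \<Sum>y<b. if x = y then 0 else (w (inv_into UNIV p (c * b + x)) (inv_into UNIV p (c * b + y)))\<^sup>2)"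
    by (simp only: integral_mult_right_zero)
  also have "\<dots> \<le> 2 / real l * ((\<Sum>i<q * b. \<Sum>j<q * b. (w i j)\<^sup>2) / real q)"
    by (intro mult_left_mono expected_within_block_sum[OF q]) auto
  finally show ?thesis by (simp add: mult.commute)
qed

text \<open>Markov's inequality, in the form that the indicator function of \<open>G\<close> dominates \<open>1 - X\<close>.\<close>

lemma prob_ge_one_minus_expect:
  assumes fin: "finite (set_pmf p)" and X: "\<And>x. x \<in> set_pmf p \<Longrightarrow> 0 \<le> X x"
    and G: "\<And>x. x \<in> set_pmf p \<Longrightarrow> X x < 1 \<Longrightarrow> x \<in> G"
  shows "1 - expect p X \<le> measure_pmf.prob p G"
proof -
  have "expect p (\<lambda>x. 1 - X x) \<le> expect p (indicator G)"
    using X G by (intro expect_mono fin) (force simp: indicator_def not_less)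
  moreover have "expect p (\<lambda>x. 1 - X x) = 1 - expect p X"
    by (subst Bochner_Integration.integral_diff) (auto intro: integrable_measure_pmf_finite[OF fin])
  ultimately show ?thesis by simp
qed

section \<open>The Gram error of the random sketch and the main bound\<close>

definition seed_block :: "nat \<Rightarrow> nat \<Rightarrow> (nat \<Rightarrow> nat) \<times> (nat \<Rightarrow> real) \<Rightarrow> real mat" where
  "seed_block l m = (\<lambda>(h, s). mat l m (\<lambda>(i, j). if h j = i then 1 else 0) * mat_diag m s)"

definition perm_mat :: "nat \<Rightarrow> (nat \<Rightarrow> nat) \<Rightarrow> real mat" where
  "perm_mat n p = mat n n (\<lambda>(i, j). if i = p j then 1 else 0)"

definition sketch_of_seed where
  "sketch_of_seed q l b = (\<lambda>(\<omega>, p).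
     (diag_block_mat (map (\<lambda>i. seed_block l b (\<omega> i)) [0..<q]), perm_mat (q * b) p))"

lemma sketch_pmf_eq_map_seeds:
  "pair_pmf (block_spemb_pmf q l b) (pmf_of_set (permutation_mats (q * b))) =
   map_pmf (sketch_of_seed q l b) (seed_pmf q l b)"
proof -
  let ?n = "q * b"
  let ?d = "(\<lambda>_. 0, \<lambda>_. 0) :: (nat \<Rightarrow> nat) \<times> (nat \<Rightarrow> real)"
  let ?S = "{p. p permutes {..<?n}}"
  have S: "finite ?S" "?S \<noteq> {}"
    using finite_permutations[of "{..<?n}"] permutes_id by blast+
  have spemb: "spemb_pmf l b = map_pmf (seed_block l b) (block_seed_pmf l b)"
    by (simp add: spemb_pmf_def seed_block_def block_seed_pmf_def)
  have "seed_block l b ?d = 0\<^sub>m l b"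
    unfolding seed_block_def prod.case by (subst mat_diag_mult_right[of _ l]) auto
  then have "Pi_pmf {..<q} (0\<^sub>m l b) (\<lambda>_. spemb_pmf l b) =
      map_pmf (\<lambda>\<omega>. seed_block l b \<circ> \<omega>) (Pi_pmf {..<q} ?d (\<lambda>_. block_seed_pmf l b))"
    unfolding spemb by (intro Pi_pmf_map) auto
  then have blocks: "block_spemb_pmf q l b =
      map_pmf (\<lambda>\<omega>. diag_block_mat (map (\<lambda>i. seed_block l b (\<omega> i)) [0..<q])) (Pi_pmf {..<q} ?d (\<lambda>_. block_seed_pmf l b))"
    by (simp add: block_spemb_pmf_def map_pmf_comp o_def)
  have "inj_on (perm_mat ?n) ?S"
  proof (rule inj_onI, rule ext)
    fix p p' j assume pp: "p \<in> ?S" "p' \<in> ?S" "perm_mat ?n p = perm_mat ?n p'"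
    show "p j = p' j"
    proof (cases "j < ?n")
      case True
      then have "p j < ?n" using pp(1) permutes_in_image[of p "{..<?n}" j] by simp
      then have "perm_mat ?n p $$ (p j, j) = 1" using True by (simp add: perm_mat_def)
      then have "perm_mat ?n p' $$ (p j, j) = 1" using pp(3) by simp
      then show ?thesis using True \<open>p j < ?n\<close> by (simp add: perm_mat_def split: if_splits)
    next
      case False
      then show ?thesis using pp(1,2) by (metis mem_Collect_eq lessThan_iff permutes_not_in)
    qed
  qed
  then have "map_pmf (perm_mat ?n) (pmf_of_set ?S) = pmf_of_set (perm_mat ?n ` ?S)"
    using S by (intro map_pmf_of_set_inj)
  moreover have "permutation_mats ?n = perm_mat ?n ` ?S"
    by (auto simp: permutation_mats_def perm_mat_def)
  ultimately have perms: "pmf_of_set (permutation_mats ?n) = map_pmf (perm_mat ?n) (pmf_of_set ?S)"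
    by simp
  show ?thesis
    unfolding blocks perms seed_pmf_def sketch_of_seed_def by (rule map_pair[symmetric])
qed

lemma mat_block_diag_block_mat:
  assumes "\<And>i. i < q \<Longrightarrow> Sb i \<in> carrier_mat l b" "i < q"
  shows "mat_block l b (diag_block_mat (map Sb [0..<q])) i i = Sb i"
  using assms
proof (induction q)
  case (Suc q)
  let ?D = "diag_block_mat (map Sb [0..<q])"
  have dims: "dim_row ?D = q * l" "dim_col ?D = q * b"
  proof -
    have "map (dim_row \<circ> Sb) [0..<q] = map (\<lambda>_. l) [0..<q]" "map (dim_col \<circ> Sb) [0..<q] = map (\<lambda>_. b) [0..<q]"
      using carrier_matD[OF Suc.prems(1)] by auto
    then show "dim_row ?D = q * l" "dim_col ?D = q * b"
      unfolding dim_diag_block_mat map_map by (simp_all only: sum_list_triv length_upt) simp_all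
  qed
  have last: "diag_block_mat (map Sb [0..<Suc q]) =
      four_block_mat ?D (0\<^sub>m (q * l) b) (0\<^sub>m l (q * b)) (Sb q)"
    using Suc.prems(1)[of q] by (simp add: diag_block_mat_last Let_def dims)
  have Sq: "dim_row (Sb q) = l" "dim_col (Sb q) = b" using Suc.prems(1)[of q] by auto
  show ?case
  proof (cases "i = q")
    case True
    show ?thesis
      unfolding last mat_block_def True using Sq dims by (intro eq_matI) auto
  next
    case False
    then have i: "i < q" using Suc.prems by simp
    have "mat_block l b (diag_block_mat (map Sb [0..<Suc q])) i i = mat_block l b ?D i i"
      unfolding last mat_block_def using block_index_less[OF i] dims Sq by (intro eq_matI) (auto simp: trans_less_add1)
    then show ?thesis using Suc.IH Suc.prems i by simp
  qed
qed simp

text \<open>Two indices meet in a bucket exactly when their hash values agree; the pairs \<open>x = y\<close> are split off because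
  the signs cancel there.\<close>

lemma bucket_gram:
  fixes f g :: "nat \<Rightarrow> real" and h :: "nat \<Rightarrow> nat" and b l :: nat
  assumes "\<And>x. x < b \<Longrightarrow> h x < l"
  shows "(\<Sum>a<l. (\<Sum>x<b. (if h x = a then f x else 0)) * (\<Sum>y<b. (if h y = a then g y else 0)))
    = (\<Sum>x<b. f x * g x) + (\<Sum>x<b. \<Sum>y<b. if x \<noteq> y \<and> h x = h y then f x * g y else 0)"
proof -
  have "(\<Sum>a<l. (\<Sum>x<b. (if h x = a then f x else 0)) * (\<Sum>y<b. (if h y = a then g y else 0)))
     = (\<Sum>a<l. \<Sum>x<b. \<Sum>y<b. if h x = a then (if h y = h x then f x * g y else 0) else 0)"
    unfolding sum_product by (intro sum.cong refl) auto
  also have "\<dots> = (\<Sum>x<b. \<Sum>a<l. \<Sum>y<b. if h x = a then (if h y = h x then f x * g y else 0) else 0)"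
    by (rule sum.swap)
  also have "\<dots> = (\<Sum>x<b. \<Sum>y<b. \<Sum>a<l. if h x = a then (if h y = h x then f x * g y else 0) else 0)"
    by (intro sum.cong refl sum.swap)
  also have "\<dots> = (\<Sum>x<b. \<Sum>y<b. if h y = h x then f x * g y else 0)"
  proof (intro sum.cong refl)
    fix x y assume "x \<in> {..<b}"
    then have "h x \<in> {..<l}" using assms by simp
    then show "(\<Sum>a<l. if h x = a then (if h y = h x then f x * g y else 0) else 0) = (if h y = h x then f x * g y else 0)"
      by (subst sum.delta') simp_all
  qed
  also have "\<dots> = (\<Sum>x<b. \<Sum>y<b. (if x = y then f x * g y else 0) + (if x \<noteq> y \<and> h x = h y then f x * g y else 0))"
    by (intro sum.cong refl) auto
  also have "\<dots> = (\<Sum>x<b. f x * g x) + (\<Sum>x<b. \<Sum>y<b. if x \<noteq> y \<and> h x = h y then f x * g y else 0)"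
    by (simp add: sum.distrib sum.delta')
  finally show ?thesis .
qed

definition incoming_block :: "nat \<Rightarrow> nat \<Rightarrow> real mat \<Rightarrow> real mat \<Rightarrow> real mat \<Rightarrow> nat \<Rightarrow> real mat" where
  "incoming_block l b A S P i = mat_block l b S i i * mat_block b (dim_col A) (P * A) i 0"

lemma gram_entry:
  fixes X :: "real mat"
  assumes "u < dim_col X" "v < dim_col X"
  shows "(X\<^sup>T * X) $$ (u, v) = (\<Sum>i<dim_row X. X $$ (i, u) * X $$ (i, v))"
  using assms by (subst mult_entry) auto

lemma incoming_block_entry:
  assumes A: "A \<in> carrier_mat (q * b) d" and p: "p permutes {..<q * b}" and i: "i < q" and a: "a < l" and u: "u < d"
    and SP: "(S, P) = sketch_of_seed q l b (\<omega>, p)"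
  shows "incoming_block l b A S P i $$ (a, u) =
    (\<Sum>x<b. if fst (\<omega> i) x = a then snd (\<omega> i) x * A $$ (inv_into UNIV p (i * b + x), u) else 0)"
proof -
  note [simp] = carrier_matD[OF A]
  obtain h s where hs: "\<omega> i = (h, s)" by (cases "\<omega> i")
  have sb: "seed_block l b z \<in> carrier_mat l b" for z
    by (cases z) (auto simp: seed_block_def mat_diag_def)
  have "mat_block l b S i i = seed_block l b (\<omega> i)"
    using SP by (simp add: sketch_of_seed_def mat_block_diag_block_mat[OF sb i])
  also have "\<dots> = mat l b (\<lambda>(i, j). (if h j = i then 1 else 0) * s j)"
    unfolding hs seed_block_def prod.case
    by (subst mat_diag_mult_right[of _ l]) (auto intro!: eq_matI)
  finally have Si: "mat_block l b S i i = mat l b (\<lambda>(i, j). (if h j = i then 1 else 0) * s j)" .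
  note lt = block_index_less[OF i, of _ b]
  have P: "P = perm_mat (q * b) p" using SP by (simp add: sketch_of_seed_def)
  have PA: "(P * A) $$ (x, u) = A $$ (inv_into UNIV p x, u)" if x: "x < q * b" for x
  proof -
    have "(P * A) $$ (x, u) = (\<Sum>y<q * b. (if x = p y then 1 else 0) * A $$ (y, u))"
      using x u by (subst mult_entry) (auto simp: P perm_mat_def)
    also have "\<dots> = (\<Sum>y<q * b. if inv_into UNIV p x = y then A $$ (y, u) else 0)"
      using permutes_inverses[OF p] by (intro sum.cong) auto
    also have "\<dots> = A $$ (inv_into UNIV p x, u)"
      using permutes_in_image[OF permutes_inv[OF p], of x] x by (simp add: sum.delta')
    finally show ?thesis .
  qed
  have dP: "dim_row (mat_block b d (P * A) i 0) = b" "dim_col (mat_block b d (P * A) i 0) = d"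
    by (auto simp: mat_block_def)
  have Pe: "mat_block b d (P * A) i 0 $$ (x, u) = A $$ (inv_into UNIV p (i * b + x), u)" if "x < b" for x
    using that u PA[OF lt[OF that]] by (simp add: mat_block_def del: index_mult_mat(1))
  have "incoming_block l b A S P i $$ (a, u) =
     (\<Sum>x<b. ((if h x = a then 1 else 0) * s x) * A $$ (inv_into UNIV p (i * b + x), u))"
    unfolding incoming_block_def Si using a u Pe by (subst mult_entry) (auto simp: dP)
  also have "\<dots> = (\<Sum>x<b. if h x = a then s x * A $$ (inv_into UNIV p (i * b + x), u) else 0)"
    by (intro sum.cong) auto
  finally show ?thesis by (simp add: hs cong: if_cong)
qed

lemma seed_support:
  assumes l: "0 < l" and z: "(\<omega>, p) \<in> set_pmf (seed_pmf q l b)"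
  shows "p permutes {..<q * b}"
    and "\<And>i x. i < q \<Longrightarrow> x < b \<Longrightarrow> fst (\<omega> i) x < l \<and> snd (\<omega> i) x * snd (\<omega> i) x = 1"
proof -
  have "finite {p. p permutes {..<q * b}}" "{p. p permutes {..<q * b}} \<noteq> {}"
    using finite_permutations[of "{..<q * b}"] permutes_id by blast+
  then show "p permutes {..<q * b}"
    using z by (simp add: seed_pmf_def)
  fix i x assume i: "i < q" and x: "x < b"
  have "\<omega> i \<in> set_pmf (block_seed_pmf l b)"
    using z i by (auto simp: seed_pmf_def set_Pi_pmf PiE_dflt_def)
  then have "fst (\<omega> i) x \<in> set_pmf (pmf_of_set {..<l})" "snd (\<omega> i) x \<in> set_pmf sign_pmf"
    using x by (auto simp: block_seed_pmf_def set_Pi_pmf PiE_dflt_def)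
  moreover have "{..<l} \<noteq> {}" using l by auto
  ultimately show "fst (\<omega> i) x < l \<and> snd (\<omega> i) x * snd (\<omega> i) x = 1"
    by (auto simp: set_pmf_of_set)
qed

text \<open>On the diagonal the signs square to one, and the diagonal terms of all blocks together run once over the
  rows of \<open>A\<close>, in permuted order. They add up to the Gram matrix of \<open>A\<close>.\<close>

lemma gram_error_eq_chaos:
  assumes A: "A \<in> carrier_mat (q * b) d" and l: "0 < l" and z: "(\<omega>, p) \<in> set_pmf (seed_pmf q l b)"
    and SP: "(S, P) = sketch_of_seed q l b (\<omega>, p)" and uv: "u < d" "v < d"
  defines "M \<equiv> stacked q l d (incoming_block l b A S P)"
  shows "(M\<^sup>T * M) $$ (u, v) = (A\<^sup>T * A) $$ (u, v) + total_chaos q b (\<lambda>x y. A $$ (x, u) * A $$ (y, v)) (\<omega>, p)"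
proof -
  note supp = seed_support[OF l z]
  note p = supp(1)
  define r where "r i x = inv_into UNIV p (i * b + x)" for i x
  have M: "dim_row M = q * l" "dim_col M = d" by (auto simp: M_def stacked_def)
  have block: "(\<Sum>a<l. M $$ (i * l + a, u) * M $$ (i * l + a, v)) =
      (\<Sum>x<b. A $$ (r i x, u) * A $$ (r i x, v)) +
      sketch_chaos b (\<lambda>x y. A $$ (r i x, u) * A $$ (r i y, v)) (\<omega> i)" if i: "i < q" for i
  proof -
    obtain h s where hs: "\<omega> i = (h, s)" by (cases "\<omega> i")
    have h: "h x < l" and s: "s x * s x = 1" if "x < b" for x
      using supp(2)[OF i that] hs by auto
    have e: "M $$ (i * l + a, w) = (\<Sum>x<b. if h x = a then s x * A $$ (r i x, w) else 0)" if "a < l" "w < d" for a w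
      unfolding M_def using stacked_entry[OF i that] incoming_block_entry[OF A p i that SP] by (simp add: hs r_def cong: if_cong)
    have "(\<Sum>a<l. M $$ (i * l + a, u) * M $$ (i * l + a, v)) =
       (\<Sum>a<l. (\<Sum>x<b. (if h x = a then s x * A $$ (r i x, u) else 0)) * (\<Sum>y<b. (if h y = a then s y * A $$ (r i y, v) else 0)))"
      using uv by (intro sum.cong) (auto simp: e)
    also have "\<dots> = (\<Sum>x<b. (s x * A $$ (r i x, u)) * (s x * A $$ (r i x, v))) +
       (\<Sum>x<b. \<Sum>y<b. if x \<noteq> y \<and> h x = h y then (s x * A $$ (r i x, u)) * (s y * A $$ (r i y, v)) else 0)"
      by (rule bucket_gram[OF h])
    also have "(\<Sum>x<b. (s x * A $$ (r i x, u)) * (s x * A $$ (r i x, v))) = (\<Sum>x<b. A $$ (r i x, u) * A $$ (r i x, v))"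
    proof (intro sum.cong refl)
      fix x assume "x \<in> {..<b}"
      then have "s x * s x = 1" using s by simp
      moreover have "(s x * A $$ (r i x, u)) * (s x * A $$ (r i x, v)) = (s x * s x) * (A $$ (r i x, u) * A $$ (r i x, v))"
        by (simp only: mult_ac)
      ultimately show "(s x * A $$ (r i x, u)) * (s x * A $$ (r i x, v)) = A $$ (r i x, u) * A $$ (r i x, v)"
        by simp
    qed
    also have "(\<Sum>x<b. \<Sum>y<b. if x \<noteq> y \<and> h x = h y then (s x * A $$ (r i x, u)) * (s y * A $$ (r i y, v)) else 0) =
        sketch_chaos b (\<lambda>x y. A $$ (r i x, u) * A $$ (r i y, v)) (\<omega> i)"
      unfolding hs sketch_chaos_def prod.case by (intro sum.cong refl) auto
    finally show ?thesis .
  qed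
  have "(M\<^sup>T * M) $$ (u, v) = (\<Sum>i<q. \<Sum>a<l. M $$ (i * l + a, u) * M $$ (i * l + a, v))"
    using uv by (subst gram_entry) (auto simp: M sum_lessThan_mult)
  also have "\<dots> = (\<Sum>i<q. \<Sum>x<b. A $$ (r i x, u) * A $$ (r i x, v)) + total_chaos q b (\<lambda>x y. A $$ (x, u) * A $$ (y, v)) (\<omega>, p)"
    unfolding total_chaos_def prod.case sum.distrib[symmetric] r_def[symmetric]
    by (intro sum.cong refl block) auto
  also have "(\<Sum>i<q. \<Sum>x<b. A $$ (r i x, u) * A $$ (r i x, v)) = (\<Sum>y<q * b. A $$ (inv_into UNIV p y, u) * A $$ (inv_into UNIV p y, v))"
    unfolding r_def sum_lessThan_mult ..
  also have "\<dots> = (\<Sum>y<q * b. A $$ (y, u) * A $$ (y, v))"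
    by (rule sum.reindex_bij_betw[OF permutes_imp_bij[OF permutes_inv[OF p]]])
  also have "\<dots> = (A\<^sup>T * A) $$ (u, v)"
    using A uv by (subst gram_entry) auto
  finally show ?thesis .
qed

lemma total_chaos_sum: "total_chaos q b (\<lambda>x y. \<Sum>u\<in>I. w u x y) z = (\<Sum>u\<in>I. total_chaos q b (w u) z)"
proof -
  obtain \<omega> p where z: "z = (\<omega>, p)" by (cases z)
  have *: "sketch_chaos b (\<lambda>x y. \<Sum>u\<in>I. w u x y) y = (\<Sum>u\<in>I. sketch_chaos b (w u) y)" for w and y :: "(nat \<Rightarrow> nat) \<times> (nat \<Rightarrow> real)"
  proof -
    obtain h s where y: "y = (h, s)" by (cases y)
    have "sketch_chaos b (\<lambda>x y. \<Sum>u\<in>I. w u x y) y = (\<Sum>x<b. \<Sum>y<b. \<Sum>u\<in>I. if x \<noteq> y \<and> h x = h y then s x * s y * w u x y else 0)"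
      unfolding y sketch_chaos_def prod.case by (intro sum.cong refl) (simp add: sum_distrib_left)
    also have "\<dots> = (\<Sum>x<b. \<Sum>u\<in>I. \<Sum>y<b. if x \<noteq> y \<and> h x = h y then s x * s y * w u x y else 0)"
      by (intro sum.cong refl sum.swap)
    also have "\<dots> = (\<Sum>u\<in>I. \<Sum>x<b. \<Sum>y<b. if x \<noteq> y \<and> h x = h y then s x * s y * w u x y else 0)"
      by (rule sum.swap)
    finally show ?thesis unfolding y sketch_chaos_def prod.case .
  qed
  show ?thesis
    unfolding z total_chaos_def prod.case * by (rule sum.swap)
qed

text \<open>The weights of a single Gram entry are products \<open>A\<^sub>x\<^sub>u A\<^sub>y\<^sub>v\<close>, so their squares sum to \<open>|A|\<^sup>4\<close> over all entries.
  The weights for the trace are inner products of rows, and the Cauchy-Schwarz inequality gives the same bound.\<close>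

lemma gram_error_moments:
  assumes A: "A \<in> carrier_mat (q * b) d" and l: "0 < l" and q: "0 < q"
  shows "expect (seed_pmf q l b) (\<lambda>z. \<Sum>u<d. \<Sum>v<d. (total_chaos q b (\<lambda>x y. A $$ (x, u) * A $$ (y, v)) z)\<^sup>2)
      \<le> 2 / real (q * l) * (frob_sq A)\<^sup>2"
    and "expect (seed_pmf q l b) (\<lambda>z. (total_chaos q b (\<lambda>x y. \<Sum>u<d. A $$ (x, u) * A $$ (y, u)) z)\<^sup>2)
      \<le> 2 / real (q * l) * (frob_sq A)\<^sup>2"
proof -
  note fin = finite_seeds[OF l, of q b]
  have row: "frob_sq A = (\<Sum>x<q * b. \<Sum>u<d. (A $$ (x, u))\<^sup>2)"
    using A by (simp add: frob_inner_def power2_eq_square)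
  have sq: "(frob_sq A)\<^sup>2 = (\<Sum>x<q * b. \<Sum>y<q * b. (\<Sum>u<d. (A $$ (x, u))\<^sup>2) * (\<Sum>v<d. (A $$ (y, v))\<^sup>2))"
    unfolding row power2_eq_square[of "sum _ _"] by (rule sum_product)
  have "expect (seed_pmf q l b) (\<lambda>z. \<Sum>u<d. \<Sum>v<d. (total_chaos q b (\<lambda>x y. A $$ (x, u) * A $$ (y, v)) z)\<^sup>2)
     = (\<Sum>u<d. \<Sum>v<d. expect (seed_pmf q l b) (\<lambda>z. (total_chaos q b (\<lambda>x y. A $$ (x, u) * A $$ (y, v)) z)\<^sup>2))"
    by (simp only: expect_sum[OF fin])
  also have "\<dots> \<le> (\<Sum>u<d. \<Sum>v<d. 2 / real (q * l) * (\<Sum>x<q * b. \<Sum>y<q * b. (A $$ (x, u) * A $$ (y, v))\<^sup>2))"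
    by (intro sum_mono total_chaos_second_moment l q)
  also have "\<dots> = 2 / real (q * l) * (\<Sum>u<d. \<Sum>v<d. \<Sum>x<q * b. \<Sum>y<q * b. (A $$ (x, u))\<^sup>2 * (A $$ (y, v))\<^sup>2)"
    by (simp only: sum_distrib_left power_mult_distrib)
  also have "(\<Sum>u<d. \<Sum>v<d. \<Sum>x<q * b. \<Sum>y<q * b. (A $$ (x, u))\<^sup>2 * (A $$ (y, v))\<^sup>2)
      = (\<Sum>u<d. \<Sum>v<d. (\<Sum>x<q * b. (A $$ (x, u))\<^sup>2) * (\<Sum>y<q * b. (A $$ (y, v))\<^sup>2))"
    by (simp only: sum_product)
  also have "\<dots> = (\<Sum>u<d. \<Sum>x<q * b. (A $$ (x, u))\<^sup>2) * (\<Sum>v<d. \<Sum>y<q * b. (A $$ (y, v))\<^sup>2)"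
    by (rule sum_product[symmetric])
  also have "\<dots> = (frob_sq A)\<^sup>2"
    unfolding row power2_eq_square[of "sum _ _"] by (subst (1 2) sum.swap) (rule refl)
  finally show "expect (seed_pmf q l b) (\<lambda>z. \<Sum>u<d. \<Sum>v<d. (total_chaos q b (\<lambda>x y. A $$ (x, u) * A $$ (y, v)) z)\<^sup>2)
      \<le> 2 / real (q * l) * (frob_sq A)\<^sup>2" .
  have "expect (seed_pmf q l b) (\<lambda>z. (total_chaos q b (\<lambda>x y. \<Sum>u<d. A $$ (x, u) * A $$ (y, u)) z)\<^sup>2)
     \<le> 2 / real (q * l) * (\<Sum>x<q * b. \<Sum>y<q * b. (\<Sum>u<d. A $$ (x, u) * A $$ (y, u))\<^sup>2)"
    by (intro total_chaos_second_moment l q)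
  also have "\<dots> \<le> 2 / real (q * l) * (frob_sq A)\<^sup>2"
    unfolding sq by (intro mult_left_mono sum_mono Cauchy_Schwarz_ineq_sum) auto
  finally show "expect (seed_pmf q l b) (\<lambda>z. (total_chaos q b (\<lambda>x y. \<Sum>u<d. A $$ (x, u) * A $$ (y, u)) z)\<^sup>2)
      \<le> 2 / real (q * l) * (frob_sq A)\<^sup>2" .
qed

lemma spfd_output_error:
  assumes A: "A \<in> carrier_mat (q * b) d" and q: "0 < q"
    and Ak: "Ak \<in> carrier_mat (q * b) d" "mat_rank Ak \<le> k"
    and out: "spfd_output A l k q S P B At" and R: "best_rank_approx_in_rows B k A R"
  defines "M \<equiv> stacked q l d (incoming_block l b A S P)"
  shows "frob_sq (A - At) = frob_sq (A - R)"
    and "\<exists>\<Delta>\<ge>0. real l * \<Delta> \<le> frob_sq M \<and> frob_sq (A - R) \<le> frob_sq (A - Ak) + real k * \<Delta> +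
      sqrt (2 * real k) * frob_norm (M\<^sup>T * M - A\<^sup>T * A)"
proof -
  let ?C = "incoming_block l b A S P"
  have div: "q * b div q = b" using q by simp
  obtain B0 V r Y where buf: "spfd_buffer l d ?C (q - 1) B0" and B: "B = mat_block l d B0 0 0"
    and V: "V \<in> carrier_mat d r" "V\<^sup>T * V = 1\<^sub>m r"
    and span: "vec_space.col_space d V = vec_space.row_space d B"
    and Y: "best_rank_approx k (A * V) Y" "At = Y * V\<^sup>T"
    using out A unfolding spfd_output_def Let_def incoming_block_def by (auto simp: div)
  have Bc: "B \<in> carrier_mat l d" by (simp add: B mat_block_def)
  have C: "?C i \<in> carrier_mat l d" for i
    using A by (auto simp: incoming_block_def mat_block_def intro: carrier_matI)
  have Mc: "M \<in> carrier_mat (q * l) d" by (simp add: M_def stacked_def)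
  show "frob_sq (A - At) = frob_sq (A - R)"
    unfolding Y(2) by (rule projected_error_eq_row_space_error[OF A Bc V span Y(1) R])
  have upto: "{..q - 1} = {..<q}" using q by auto
  have mass: "(\<Sum>j\<le>q - 1. frob_sq (?C j * N)) = frob_sq (M * N)" if "N \<in> carrier_mat d c" for N c
    unfolding M_def upto by (rule frob_sq_stacked_mult[OF C that, symmetric])
  have mass1: "(\<Sum>j\<le>q - 1. frob_sq (?C j)) = frob_sq M"
    using mass[of "1\<^sub>m d" d] C Mc by (simp add: right_mult_one_mat[OF C] right_mult_one_mat[OF Mc])
  obtain \<Delta> where \<Delta>: "0 \<le> \<Delta>" and B0: "B0 \<in> carrier_mat (2 * l) d"
    and zero: "\<And>i j. l \<le> i \<Longrightarrow> i < 2 * l \<Longrightarrow> j < d \<Longrightarrow> B0 $$ (i, j) = 0"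
    and bounds: "\<And>c N. N \<in> carrier_mat d c \<Longrightarrow> frob_sq (B0 * N) \<le> (\<Sum>j\<le>q - 1. frob_sq (?C j * N)) \<and>
          (\<Sum>j\<le>q - 1. frob_sq (?C j * N)) \<le> frob_sq (B0 * N) + \<Delta> * frob_sq N"
    and tr: "frob_sq B0 + real l * \<Delta> \<le> (\<Sum>j\<le>q - 1. frob_sq (?C j))"
    using spfd_buffer_bounds[OF buf C] by blast
  have top: "frob_sq (B * N) = frob_sq (B0 * N)" if "N \<in> carrier_mat d c" for N c
    unfolding B by (rule frob_sq_top_block_mult[OF B0 zero that])
  have "frob_sq (B * N) \<le> frob_sq (M * N)" "frob_sq (M * N) \<le> frob_sq (B * N) + \<Delta> * frob_sq N"
    if "N \<in> carrier_mat d d" for N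
    using bounds[OF that] unfolding top[OF that] mass[OF that] by auto
  from sketch_row_space_error[OF A Ak Bc Mc \<Delta> this]
  obtain X where X: "X \<in> carrier_mat (q * b) l" "mat_rank X \<le> k"
    "frob_sq (A - X * B) \<le> frob_sq (A - Ak) + real k * \<Delta> + sqrt (2 * real k) * frob_norm (M\<^sup>T * M - A\<^sup>T * A)"
    by blast
  have "frob_sq (A - R) \<le> frob_sq (A - X * B)"
    using R X(1,2) A Bc by (auto simp: best_rank_approx_in_rows_def frob_norm_le_iff)
  moreover have "real l * \<Delta> \<le> frob_sq M"
    using tr mass1 frob_sq_nonneg[of B0] by simp
  ultimately show "\<exists>\<Delta>\<ge>0. real l * \<Delta> \<le> frob_sq M \<and> frob_sq (A - R) \<le> frob_sq (A - Ak) + real k * \<Delta> +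
      sqrt (2 * real k) * frob_norm (M\<^sup>T * M - A\<^sup>T * A)"
    using \<Delta> X(3) by (intro exI[of _ \<Delta>]) auto
qed

text \<open>The budget \<open>\<epsilon> a\<close> is shared equally: the first summand of \<open>small\<close> controls the Gram error \<open>F\<close>, and the
  second one keeps the squared norm \<open>m\<close> of the sketch below \<open>3 a / 2\<close>, which pays for the shrinkage \<open>\<Delta>\<close>.\<close>

lemma small_deviation_imp_error_le:
  fixes k l :: nat
  assumes k: "0 < k" and \<epsilon>: "0 < \<epsilon>" "\<epsilon> < 1" and a: "0 < (a::real)" and l: "3 * real k \<le> \<epsilon> * real l"
    and \<Delta>: "0 \<le> \<Delta>" "real l * \<Delta> \<le> m" and F: "0 \<le> F"
    and small: "8 * real k / (\<epsilon>\<^sup>2 * a\<^sup>2) * F\<^sup>2 + 4 / a\<^sup>2 * (m - a)\<^sup>2 < 1"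
  shows "real k * \<Delta> + sqrt (2 * real k) * F \<le> \<epsilon> * a"
proof -
  have nn: "0 \<le> 8 * real k / (\<epsilon>\<^sup>2 * a\<^sup>2) * F\<^sup>2" "0 \<le> 4 / a\<^sup>2 * (m - a)\<^sup>2" by auto
  then have "8 * real k / (\<epsilon>\<^sup>2 * a\<^sup>2) * F\<^sup>2 \<le> 1" "4 / a\<^sup>2 * (m - a)\<^sup>2 \<le> 1" using small by linarith+
  then have "8 * real k * F\<^sup>2 \<le> (\<epsilon> * a)\<^sup>2" "4 * (m - a)\<^sup>2 \<le> a\<^sup>2"
    using \<epsilon> a by (simp_all add: field_simps power_mult_distrib)
  then have F2: "2 * real k * F\<^sup>2 \<le> (\<epsilon> * a / 2)\<^sup>2" and m2: "(m - a)\<^sup>2 \<le> (a / 2)\<^sup>2"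
    by (simp_all add: power_divide)
  have "sqrt (2 * real k) * F = sqrt (2 * real k * F\<^sup>2)"
    using F by (simp add: real_sqrt_mult)
  also have "\<dots> \<le> \<epsilon> * a / 2"
    using F2 \<epsilon> a by (intro real_le_lsqrt) auto
  finally have gram: "sqrt (2 * real k) * F \<le> \<epsilon> * a / 2" .
  have "m - a \<le> a / 2" using m2 a by (intro power2_le_imp_le[of "m - a" "a / 2"]) auto
  then have "real l * \<Delta> \<le> 3 * a / 2" using \<Delta>(2) by simp
  then have "\<epsilon> * (real l * \<Delta>) \<le> \<epsilon> * (3 * a / 2)" using \<epsilon> by (intro mult_left_mono) auto
  moreover have "3 * (real k * \<Delta>) \<le> \<epsilon> * (real l * \<Delta>)"
    using mult_right_mono[OF l \<Delta>(1)] by (simp only: mult.assoc)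
  ultimately have "3 * (real k * \<Delta>) \<le> \<epsilon> * (3 * a / 2)" by linarith
  then show ?thesis using gram by argo
qed

theorem theorem1:
  fixes A Ak :: "real mat" and n d k q l :: nat and \<epsilon> \<delta> :: real
  assumes A: "A \<in> carrier_mat n d"
    and k: "0 < k" "k \<le> mat_rank A"
    and Ak: "best_rank_approx k A Ak"
    and eps: "0 < \<epsilon>" "\<epsilon> < 1"
    and delta: "0 < \<delta>" "\<delta> < 1"
    and q: "0 < q" "q dvd n"
    and l: "0 < l" "int l = \<lceil>real k + 3 * real k / (\<epsilon> * \<delta>)\<rceil>"
    and ql: "real (q * l) \<ge> 12 * ((real k)\<^sup>2 + real k) / (\<epsilon>\<^sup>2 * \<delta>)"
  shows "measure_pmf.prob
           (pair_pmf (block_spemb_pmf q l (n div q)) (pmf_of_set (permutation_mats n)))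
           {(S, P). \<forall>B At Pi. spfd_output A l k q S P B At \<and> best_rank_approx_in_rows B k A Pi \<longrightarrow>
              (frob_norm (A - At))\<^sup>2 = (frob_norm (A - Pi))\<^sup>2 \<and>
              (frob_norm (A - Pi))\<^sup>2 \<le> (frob_norm (A - Ak))\<^sup>2 + \<epsilon> * (frob_norm A)\<^sup>2}
         \<ge> 1 - \<delta>"
    (is "measure_pmf.prob ?p ?Good \<ge> _")
proof -
  define b where "b = n div q"
  have n: "n = q * b" using q by (simp add: b_def)
  note Ab = A[unfolded n]
  have Akc: "Ak \<in> carrier_mat (q * b) d" "mat_rank Ak \<le> k"
    using Ak A by (auto simp: best_rank_approx_def n)
  define a where "a = frob_sq A"
  \<comment> \<open>The rank hypothesis excludes \<open>A = 0\<close>, so that deviations can be measured relative to \<open>|A|\<^sup>2\<close>.\<close>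
  have "a \<noteq> 0"
  proof
    assume "a = 0"
    then have "A = 0\<^sub>m n d" using frob_sq_eq_0D[of A] A by (auto simp: a_def)
    also have "\<dots> = 0\<^sub>m n 0 * 0\<^sub>m 0 d" by (simp add: mult_zero_dims)
    finally have "mat_rank A \<le> 0"
      using rank_mult_le_inner_dim[of "0\<^sub>m n 0" n 0 "0\<^sub>m 0 d" d] by simp
    then show False using k by simp
  qed
  then have a: "0 < a" using frob_sq_nonneg[of A] by (simp add: a_def)
  have "3 * real k / (\<epsilon> * \<delta>) \<le> real l"
  proof -
    have "real k + 3 * real k / (\<epsilon> * \<delta>) \<le> of_int (int l)" unfolding l(2) by (rule le_of_int_ceiling)
    then show ?thesis by simp
  qed
  then have "3 * real k \<le> \<epsilon> * \<delta> * real l"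
    using eps delta by (simp add: field_simps)
  also have "\<dots> \<le> \<epsilon> * 1 * real l"
    using eps delta by (intro mult_right_mono mult_left_mono) auto
  finally have lk: "3 * real k \<le> \<epsilon> * real l" by simp
  let ?seeds = "seed_pmf q l b"
  define F2 where "F2 z = (\<Sum>u<d. \<Sum>v<d. (total_chaos q b (\<lambda>x y. A $$ (x, u) * A $$ (y, v)) z)\<^sup>2)" for z
  define D where "D z = total_chaos q b (\<lambda>x y. \<Sum>u<d. A $$ (x, u) * A $$ (y, u)) z" for z
  define X where "X z = 8 * real k / (\<epsilon>\<^sup>2 * a\<^sup>2) * F2 z + 4 / a\<^sup>2 * (D z)\<^sup>2" for z
  note fin = finite_seeds[OF l(1), of q b]
  have "expect ?seeds X = 8 * real k / (\<epsilon>\<^sup>2 * a\<^sup>2) * expect ?seeds F2 + 4 / a\<^sup>2 * expect ?seeds (\<lambda>z. (D z)\<^sup>2)"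
    unfolding X_def[abs_def] by (subst expect_add[OF fin]) (simp only: integral_mult_right_zero)
  also have "\<dots> \<le> 8 * real k / (\<epsilon>\<^sup>2 * a\<^sup>2) * (2 / real (q * l) * a\<^sup>2) + 4 / a\<^sup>2 * (2 / real (q * l) * a\<^sup>2)"
    using gram_error_moments[OF Ab l(1) q(1)]
    by (intro add_mono mult_left_mono) (auto simp: F2_def[abs_def] D_def a_def)
  also have "\<dots> = (16 * real k + 8 * \<epsilon>\<^sup>2) / \<epsilon>\<^sup>2 / real (q * l)"
    using a eps q l by (simp add: field_simps)
  also have "\<dots> \<le> \<delta>"
  proof -
    \<comment> \<open>\<open>12 (k\<^sup>2 + k) - (16 k + 8) = 4 (3 k + 2) (k - 1)\<close>; equality holds at \<open>k = 1\<close>.\<close>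
    have "0 \<le> (3 * real k + 2) * (real k - 1)" using k by simp
    then have "16 * real k + 8 \<le> 12 * ((real k)\<^sup>2 + real k)"
      by (simp add: algebra_simps power2_eq_square)
    moreover have "\<epsilon>\<^sup>2 \<le> 1" using eps by (simp add: power_le_one)
    ultimately have "16 * real k + 8 * \<epsilon>\<^sup>2 \<le> 12 * ((real k)\<^sup>2 + real k)" by simp
    also have "\<dots> \<le> \<delta> * real (q * l) * \<epsilon>\<^sup>2"
      using ql eps delta by (simp add: field_simps)
    finally have "(16 * real k + 8 * \<epsilon>\<^sup>2) / \<epsilon>\<^sup>2 \<le> \<delta> * real (q * l)"
      using eps by (simp add: pos_divide_le_eq)
    then show ?thesis using q l by (subst pos_divide_le_eq) auto
  qed
  finally have EX: "expect ?seeds X \<le> \<delta>" .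
  have good: "z \<in> sketch_of_seed q l b -` ?Good" if z: "z \<in> set_pmf ?seeds" and small: "X z < 1" for z
  proof -
    obtain \<omega> p where zp: "z = (\<omega>, p)" by (cases z)
    obtain S P where SP: "(S, P) = sketch_of_seed q l b (\<omega>, p)" by (cases "sketch_of_seed q l b (\<omega>, p)") auto
    define M where "M = stacked q l d (incoming_block l b A S P)"
    define E where "E = M\<^sup>T * M - A\<^sup>T * A"
    have dims: "dim_col M = d" "dim_col A = d" "dim_row E = d" "dim_col E = d"
      using A by (auto simp: M_def stacked_def E_def)
    note entry = gram_error_eq_chaos[OF Ab l(1) z[unfolded zp] SP, folded M_def zp]
    have "frob_sq E = F2 z"
      unfolding frob_inner_def F2_def dims
      by (intro sum.cong refl) (simp add: E_def dims entry power2_eq_square del: index_mult_mat(1))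
    then have EF: "(frob_norm E)\<^sup>2 = F2 z" by (simp add: frob_norm_sq)
    have tr: "frob_sq N = (\<Sum>u<dim_col N. (N\<^sup>T * N) $$ (u, u))" for N
      unfolding frob_inner_def by (subst sum.swap) (simp add: gram_entry del: index_mult_mat(1))
    have "frob_sq M = (\<Sum>u<d. (A\<^sup>T * A) $$ (u, u) + total_chaos q b (\<lambda>x y. A $$ (x, u) * A $$ (y, u)) z)"
      unfolding tr[of M] dims by (intro sum.cong refl entry) auto
    also have "\<dots> = a + D z"
      unfolding D_def total_chaos_sum a_def tr[of A] dims sum.distrib ..
    finally have MD: "D z = frob_sq M - a" by simp
    have "(frob_norm (A - At))\<^sup>2 = (frob_norm (A - R))\<^sup>2 \<and>
        (frob_norm (A - R))\<^sup>2 \<le> (frob_norm (A - Ak))\<^sup>2 + \<epsilon> * (frob_norm A)\<^sup>2"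
      if out: "spfd_output A l k q S P B At" and R: "best_rank_approx_in_rows B k A R" for B At R
    proof -
      note err = spfd_output_error[OF Ab q(1) Akc out R, folded M_def E_def]
      obtain \<Delta> where \<Delta>: "0 \<le> \<Delta>" "real l * \<Delta> \<le> frob_sq M"
        and le: "frob_sq (A - R) \<le> frob_sq (A - Ak) + real k * \<Delta> + sqrt (2 * real k) * frob_norm E"
        using err(2) by blast
      have "real k * \<Delta> + sqrt (2 * real k) * frob_norm E \<le> \<epsilon> * a"
        using small unfolding X_def MD EF[symmetric]
        by (intro small_deviation_imp_error_le[OF k(1) eps a lk \<Delta>]) (auto simp: frob_norm_def sum_nonneg)
      then show ?thesis
        using err(1) le by (simp add: frob_norm_sq a_def)
    qed
    then show ?thesis
      unfolding zp vimage_def mem_Collect_eq SP[symmetric] prod.case by blast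
  qed
  have "0 \<le> F2 z" for z by (simp add: F2_def sum_nonneg)
  then have "0 \<le> X z" for z by (simp add: X_def)
  then have "1 - expect ?seeds X \<le> measure_pmf.prob ?seeds (sketch_of_seed q l b -` ?Good)"
    by (intro prob_ge_one_minus_expect[OF fin] good)
  also have "\<dots> = measure_pmf.prob ?p ?Good"
    unfolding b_def[symmetric] unfolding n sketch_pmf_eq_map_seeds measure_map_pmf ..
  finally show ?thesis using EX by simp
qed

end
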